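(* Let $M$ be an Artin monoid and $\varphi\in\mathrm{End}(M)$. The following properties are equivalent: (i) $\varphi$ is uniformly continuous with respect to $d_1$, and its unique continuous extension $\Phi:\widehat{M}\to\widehat{M}$ is a contraction with respect to $d_1$; (ii) $\varphi$ is a contraction with respect to $d_1$; (iii) for all $u,v\in M_{\mathrm{red}}$, $\alpha(uv)=u$ implies $\alpha(\varphi(uv))=\alpha(\varphi(u))$; (iv) for all $u\in M$, $\alpha(\varphi(u))=\alpha(\varphi(\alpha(u)))$. Furthermore, in these cases, if $u=u_1u_2\cdots\in\widehat{M}$ and $\Phi(u)=U_1U_2\cdots$ (written in normal form), then for all integers $m\ge1$ with $m\le|u|_1$, one has $\iota_1(\varphi(u_1\cdots u_m))=(U_1,\dots,U_m,\dots)$, i.e. the greedy normal form of $\varphi(u_1\cdots u_m)$ begins with the terms $U_1,\dots,U_m$.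
   Context: Artin monoid: $M=\langle S\mid [a,b\rangle^{m_{ab}}=[b,a\rangle^{m_{ab}},\ m_{ab}\ne\infty\rangle^+$, where $S$ is a nonempty finite set, $(m_{ab})_{a,b\in S}$ is a symmetric matrix with entries in $\{1,2,\dots,\infty\}$, $m_{aa}=1$, $m_{ab}\ge2$ for $a\neq b$, and $[a,b\rangle^m=aba\cdots$ ($m$ factors). $\mathrm{End}(M)$ is the monoid of endomorphisms of $M$. $\ell_S$ is the word length on $M$ over $S$. $W=\langle S\mid (ab)^{m_{ab}}=1,\ m_{ab}\ne\infty\rangle$ is the corresponding Coxeter group with its usual length function. $M_{\mathrm{red}}$ is the set of elements of $M$ having the same length as their image in $W$. $a\preceq b$ means $b=ac$ for some $c\in M$. For $u\in M$, $\alpha(u)$ denotes the unique maximal element for $\preceq$ of $\{v\in M_{\mathrm{red}}:v\preceq u\}$; it satisfies $\alpha(uv)=\alpha(u\alpha(v))$. Greedy normal form: for $u\ne1$, the unique sequence $\iota_1(u)=(u_1,\dots,u_n)$ in $M_{\mathrm{red}}\setminus\{1\}$ with $u=u_1\cdots u_n$ and $u_i=\alpha(u_i\cdots u_n)$ for all $i$; $\iota_1(1)$ is the empty sequence; $|u|_1=n$ is the number of terms. Boundary and completion: $\partial M$ is the set of infinite sequences $u_1u_2\cdots$ with $u_i\in M_{\mathrm{red}}$ such that $u_1\cdots u_n$ is a greedy normal form for every $n$ (in particular no $u_i$ equals $1$); $\widehat{M}=M\cup\partial M$. An element of $\widehat M$ is identified with its (finite or infinite) normal form sequence $u_1u_2\cdots$,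 and $|u|_1=\infty$ for $u\in\partial M$. For distinct $u,v\in\widehat M$, $r_1(u,v)$ is the largest $k\ge0$ such that both sequences have at least $k$ terms and agree in their first $k$ terms; $r_1(u,u)=\infty$; $d_1(u,v)=2^{-r_1(u,v)}$ with $2^{-\infty}=0$. Then $(\widehat M,d_1)$ is the completion of $(M,d_1)$; if $\varphi$ is uniformly continuous with respect to $d_1$, $\Phi$ denotes the unique continuous extension of $\varphi$ to $\widehat M$. A map $f$ of a metric space $(X,d)$ to itself is a contraction with respect to $d$ if $d(f(x),f(y))\le d(x,y)$ for all $x,y\in X$. *)

theory Defs
  imports
    "HOL-Analysis.Abstract_Metric_Spaces"
    "HOL-Algebra.Divisibility"
    "HOL-Library.Extended_Nat"
begin

section \<open>Presented monoids and groups\<close>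

text \<open>
  The congruence on the free monoid of words over \<open>X\<close> generated by the pairs in \<open>R\<close>.
\<close>

inductive pres_cong :: "'x set \<Rightarrow> ('x list \<times> 'x list) set \<Rightarrow> 'x list \<Rightarrow> 'x list \<Rightarrow> bool"
  for X :: "'x set" and R :: "('x list \<times> 'x list) set" where
  refl: "u \<in> lists X \<Longrightarrow> pres_cong X R u u"
| sym: "pres_cong X R u v \<Longrightarrow> pres_cong X R v u"
| trans: "pres_cong X R u v \<Longrightarrow> pres_cong X R v w \<Longrightarrow> pres_cong X R u w"
| rel: "(l, r) \<in> R \<Longrightarrow> l \<in> lists X \<Longrightarrow> r \<in> lists X \<Longrightarrow> p \<in> lists X \<Longrightarrow> q \<in> lists X
    \<Longrightarrow> pres_cong X R (p @ l @ q) (p @ r @ q)"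

definition word_class ::
  "'x set \<Rightarrow> ('x list \<times> 'x list) set \<Rightarrow> 'x list \<Rightarrow> 'x list set" where
  "word_class X R u = {v. pres_cong X R u v}"

definition pres_monoid :: "'x set \<Rightarrow> ('x list \<times> 'x list) set \<Rightarrow> 'x list set monoid" where
  "pres_monoid X R =
    \<lparr> carrier = word_class X R ` lists X,
      mult = (\<lambda>A B. \<Union>u\<in>A. \<Union>v\<in>B. word_class X R (u @ v)),
      one = word_class X R [] \<rparr>"

text \<open>
  The group with generators \<open>X\<close> and relators \<open>R\<close>: the letter \<open>(x, True)\<close> stands for the
  generator \<open>x\<close> and \<open>(x, False)\<close> for its formal inverse.
\<close>

definition group_relations ::
  "'x set \<Rightarrow> ('x \<times> bool) list set \<Rightarrow> (('x \<times> bool) list \<times> ('x \<times> bool) list) set" where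
  "group_relations X R =
    {(r, []) | r. r \<in> R} \<union> {([(x, e), (x, \<not> e)], []) | x e. x \<in> X}"

definition pres_group :: "'x set \<Rightarrow> ('x \<times> bool) list set \<Rightarrow> ('x \<times> bool) list set monoid" where
  "pres_group X R = pres_monoid (X \<times> UNIV) (group_relations X R)"

definition mprod :: "('c, 'd) monoid_scheme \<Rightarrow> 'c list \<Rightarrow> 'c" where
  "mprod G us = foldr (\<otimes>\<^bsub>G\<^esub>) us \<one>\<^bsub>G\<^esub>"

definition gen_length :: "('c, 'd) monoid_scheme \<Rightarrow> 'c set \<Rightarrow> 'c \<Rightarrow> nat" where
  "gen_length G A x = (LEAST n. \<exists>us \<in> lists A. length us = n \<and> mprod G us = x)"

definition monoid_End :: "('c, 'd) monoid_scheme \<Rightarrow> ('c \<Rightarrow> 'c) set" where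
  "monoid_End G = {f \<in> hom G G. f \<one>\<^bsub>G\<^esub> = \<one>\<^bsub>G\<^esub>}"


section \<open>Artin monoids and Coxeter groups\<close>

definition coxeter_matrix :: "'a set \<Rightarrow> ('a \<Rightarrow> 'a \<Rightarrow> enat) \<Rightarrow> bool" where
  "coxeter_matrix S m \<longleftrightarrow> finite S \<and> S \<noteq> {} \<and>
    (\<forall>a\<in>S. \<forall>b\<in>S. m a b = m b a) \<and>
    (\<forall>a\<in>S. m a a = 1) \<and>
    (\<forall>a\<in>S. \<forall>b\<in>S. a \<noteq> b \<longrightarrow> 2 \<le> m a b)"

fun alt_word :: "'a \<Rightarrow> 'a \<Rightarrow> nat \<Rightarrow> 'a list" where
  "alt_word a b 0 = []"
| "alt_word a b (Suc n) = a # alt_word b a n"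

definition artin_relations :: "'a set \<Rightarrow> ('a \<Rightarrow> 'a \<Rightarrow> enat) \<Rightarrow> ('a list \<times> 'a list) set" where
  "artin_relations S m =
    {(alt_word a b k, alt_word b a k) | a b k. a \<in> S \<and> b \<in> S \<and> m a b = enat k}"

definition artin_monoid :: "'a set \<Rightarrow> ('a \<Rightarrow> 'a \<Rightarrow> enat) \<Rightarrow> 'a list set monoid" where
  "artin_monoid S m = pres_monoid S (artin_relations S m)"

definition artin_gens :: "'a set \<Rightarrow> ('a \<Rightarrow> 'a \<Rightarrow> enat) \<Rightarrow> 'a list set set" where
  "artin_gens S m = (\<lambda>a. word_class S (artin_relations S m) [a]) ` S"

definition coxeter_relators :: "'a set \<Rightarrow> ('a \<Rightarrow> 'a \<Rightarrow> enat) \<Rightarrow> ('a \<times> bool) list set" where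
  "coxeter_relators S m =
    {concat (replicate k [(a, True), (b, True)]) | a b k. a \<in> S \<and> b \<in> S \<and> m a b = enat k}"

definition coxeter_group :: "'a set \<Rightarrow> ('a \<Rightarrow> 'a \<Rightarrow> enat) \<Rightarrow> ('a \<times> bool) list set monoid" where
  "coxeter_group S m = pres_group S (coxeter_relators S m)"

definition coxeter_class ::
  "'a set \<Rightarrow> ('a \<Rightarrow> 'a \<Rightarrow> enat) \<Rightarrow> 'a list \<Rightarrow> ('a \<times> bool) list set" where
  "coxeter_class S m w =
    word_class (S \<times> UNIV) (group_relations S (coxeter_relators S m)) (map (\<lambda>a. (a, True)) w)"

definition coxeter_gens :: "'a set \<Rightarrow> ('a \<Rightarrow> 'a \<Rightarrow> enat) \<Rightarrow> ('a \<times> bool) list set set" where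
  "coxeter_gens S m = (\<lambda>a. coxeter_class S m [a]) ` S"

text \<open>
  The canonical homomorphism from the Artin monoid to the Coxeter group; the sets in the
  union all coincide, since the defining relations of the monoid hold in the group.
\<close>

definition coxeter_image ::
  "'a set \<Rightarrow> ('a \<Rightarrow> 'a \<Rightarrow> enat) \<Rightarrow> 'a list set \<Rightarrow> ('a \<times> bool) list set" where
  "coxeter_image S m u = (\<Union>w\<in>u. coxeter_class S m w)"

definition artin_red :: "'a set \<Rightarrow> ('a \<Rightarrow> 'a \<Rightarrow> enat) \<Rightarrow> 'a list set set" where
  "artin_red S m =
    {u \<in> carrier (artin_monoid S m).
      gen_length (artin_monoid S m) (artin_gens S m) u =
      gen_length (coxeter_group S m) (coxeter_gens S m) (coxeter_image S m u)}"

text \<open>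
  The order on the monoid is left divisibility, which is what \<^const>\<open>factor\<close> expresses in
  the absence of commutativity.
\<close>

definition alpha :: "'a set \<Rightarrow> ('a \<Rightarrow> 'a \<Rightarrow> enat) \<Rightarrow> 'a list set \<Rightarrow> 'a list set" where
  "alpha S m u = (THE v.
    v \<in> artin_red S m \<and> v divides\<^bsub>artin_monoid S m\<^esub> u \<and>
    (\<forall>w \<in> artin_red S m. w divides\<^bsub>artin_monoid S m\<^esub> u \<and> v divides\<^bsub>artin_monoid S m\<^esub> w
      \<longrightarrow> w = v))"


section \<open>Greedy normal forms\<close>

definition greedy_nf :: "'a set \<Rightarrow> ('a \<Rightarrow> 'a \<Rightarrow> enat) \<Rightarrow> 'a list set list \<Rightarrow> bool" where
  "greedy_nf S m us \<longleftrightarrow>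
    set us \<subseteq> artin_red S m - {\<one>\<^bsub>artin_monoid S m\<^esub>} \<and>
    (\<forall>i < length us. us ! i = alpha S m (mprod (artin_monoid S m) (drop i us)))"

definition iota1 :: "'a set \<Rightarrow> ('a \<Rightarrow> 'a \<Rightarrow> enat) \<Rightarrow> 'a list set \<Rightarrow> 'a list set list" where
  "iota1 S m u =
    (if u = \<one>\<^bsub>artin_monoid S m\<^esub> then []
     else (THE us. greedy_nf S m us \<and> mprod (artin_monoid S m) us = u))"


section \<open>Boundary, completion and metric\<close>

definition artin_boundary :: "'a set \<Rightarrow> ('a \<Rightarrow> 'a \<Rightarrow> enat) \<Rightarrow> (nat \<Rightarrow> 'a list set) set" where
  "artin_boundary S m = {f. \<forall>n. greedy_nf S m (map f [0..<n])}"

text \<open>Monoid elements are tagged with \<^const>\<open>Inl\<close>, boundary points with \<^const>\<open>Inr\<close>.\<close>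

type_synonym 'a completed = "'a list set + (nat \<Rightarrow> 'a list set)"

definition artin_completion :: "'a set \<Rightarrow> ('a \<Rightarrow> 'a \<Rightarrow> enat) \<Rightarrow> 'a completed set" where
  "artin_completion S m = carrier (artin_monoid S m) <+> artin_boundary S m"

definition nf_length :: "'a set \<Rightarrow> ('a \<Rightarrow> 'a \<Rightarrow> enat) \<Rightarrow> 'a completed \<Rightarrow> enat" where
  "nf_length S m x = (case x of Inl u \<Rightarrow> enat (length (iota1 S m u)) | Inr f \<Rightarrow> \<infinity>)"

text \<open>
  The first \<open>k\<close> terms of the normal form; the whole normal form if it has fewer than \<open>k\<close> terms.
\<close>

definition nf_take :: "'a set \<Rightarrow> ('a \<Rightarrow> 'a \<Rightarrow> enat) \<Rightarrow> nat \<Rightarrow> 'a completed \<Rightarrow> 'a list set list" where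
  "nf_take S m k x = (case x of Inl u \<Rightarrow> take k (iota1 S m u) | Inr f \<Rightarrow> map f [0..<k])"

definition r1 :: "'a set \<Rightarrow> ('a \<Rightarrow> 'a \<Rightarrow> enat) \<Rightarrow> 'a completed \<Rightarrow> 'a completed \<Rightarrow> enat" where
  "r1 S m x y =
    (if x = y then \<infinity>
     else enat (GREATEST k. enat k \<le> nf_length S m x \<and> enat k \<le> nf_length S m y \<and>
                            nf_take S m k x = nf_take S m k y))"

definition d1 :: "'a set \<Rightarrow> ('a \<Rightarrow> 'a \<Rightarrow> enat) \<Rightarrow> 'a completed \<Rightarrow> 'a completed \<Rightarrow> real" where
  "d1 S m x y = (case r1 S m x y of enat k \<Rightarrow> (1 / 2) ^ k | \<infinity> \<Rightarrow> 0)"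

definition d1_fin :: "'a set \<Rightarrow> ('a \<Rightarrow> 'a \<Rightarrow> enat) \<Rightarrow> 'a list set \<Rightarrow> 'a list set \<Rightarrow> real" where
  "d1_fin S m u v = d1 S m (Inl u) (Inl v)"

definition artin_metric :: "'a set \<Rightarrow> ('a \<Rightarrow> 'a \<Rightarrow> enat) \<Rightarrow> 'a list set metric" where
  "artin_metric S m = metric (carrier (artin_monoid S m), d1_fin S m)"

definition completion_metric :: "'a set \<Rightarrow> ('a \<Rightarrow> 'a \<Rightarrow> enat) \<Rightarrow> 'a completed metric" where
  "completion_metric S m = metric (artin_completion S m, d1 S m)"

text \<open>
  The unique continuous extension of \<open>\<phi>\<close>; \<^const>\<open>extensional\<close> fixes its values outside the
  completion, so that uniqueness makes sense for total functions.
\<close>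

definition completion_ext ::
  "'a set \<Rightarrow> ('a \<Rightarrow> 'a \<Rightarrow> enat) \<Rightarrow> ('a list set \<Rightarrow> 'a list set) \<Rightarrow> 'a completed \<Rightarrow> 'a completed" where
  "completion_ext S m \<phi> = (THE \<Phi>.
    \<Phi> \<in> extensional (artin_completion S m) \<and>
    continuous_map (mtopology_of (completion_metric S m)) (mtopology_of (completion_metric S m)) \<Phi> \<and>
    (\<forall>u \<in> carrier (artin_monoid S m). \<Phi> (Inl u) = Inl (\<phi> u)))"

text \<open>A contraction here need not shrink distances strictly.\<close>

definition contraction_on :: "'c set \<Rightarrow> ('c \<Rightarrow> 'c \<Rightarrow> real) \<Rightarrow> ('c \<Rightarrow> 'c) \<Rightarrow> bool" where
  "contraction_on X d f \<longleftrightarrow> f \<in> X \<rightarrow> X \<and> (\<forall>x\<in>X. \<forall>y\<in>X. d (f x) (f y) \<le> d x y)"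

end

theory Submission
  imports Defs "HOL-Analysis.Urysohn"
begin

text \<open>
  Write \<open>M\<close> for the Artin monoid. Everything about endomorphisms rests on three facts:
  \<open>M\<close> is left cancellative, every \<open>u\<close> has a greatest reduced left divisor \<open>\<alpha> u\<close>, and
  \<open>\<alpha> (x y) = \<alpha> (x (\<alpha> y))\<close>. They say that the normal form of \<open>u\<close> is \<open>\<alpha> u\<close> followed by the
  normal form of the \<open>rest\<close> of \<open>u\<close>, and that a sequence of reduced elements is a normal form as
  soon as every two consecutive terms satisfy \<open>\<alpha> (a b) = a\<close>.

  From (iv) to (ii). Let the normal forms of \<open>u\<close> and \<open>v\<close> agree in \<open>Suc k\<close> terms, the first one
  being \<open>a\<close>. By (iv) the normal forms of \<open>\<phi> u\<close> and \<open>\<phi> v\<close> both begin with \<open>\<alpha> (\<phi> a)\<close>. What then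
  remains of them is \<open>x (\<phi> (rest u))\<close> and \<open>x (\<phi> (rest v))\<close> with the same \<open>x\<close>. By induction
  \<open>\<phi> (rest u)\<close> and \<open>\<phi> (rest v)\<close> agree in \<open>k\<close> terms, and left multiplication by \<open>x\<close> preserves this
  (\<open>agree_mult_left\<close>), because \<open>\<alpha> (x y)\<close> depends on \<open>\<alpha> y\<close> only. From (iii) to (iv): by
  induction on the length, \<open>\<alpha> (\<phi> u)\<close> depends only on the first two terms of the normal form of
  \<open>u\<close>, and for these (iii) applies. The implications from (ii) to (iii) and from (iv) to (iii)
  are immediate from the definitions.

  For the completion, finite normal forms are continued by \<open>1\<close> for ever. Then the completion is
  the set of all sequences of reduced elements with \<open>\<alpha> (f i f (i + 1)) = f i\<close>, and the distance
  of two points is determined by the first index at which they differ (\<open>d1_le_iff\<close>). The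
  condition on \<open>f\<close> is local, so the space is complete and uniformly continuous maps of \<open>M\<close>
  extend to it. If \<open>\<phi>\<close> is a contraction, its extension at \<open>x\<close> agrees in \<open>k\<close> terms with the value
  of \<open>\<phi>\<close> at the product of the first \<open>k\<close> terms of \<open>x\<close>
  (\<open>completion_ext_agree_truncation\<close>). This gives (i) as well as the statement about normal
  forms.

  The three facts come from the Coxeter group. The sign of the geometric representation decides
  whether a generator lengthens an element (\<open>root_sign_pos\<close>). This describes the cosets of the
  dihedral subgroups, and hence shows that equivalent reduced words differ by braid relations
  (\<open>weq_imp_acong_of_red\<close>). The heart of the matter is \<open>all_heads_joined\<close>: if \<open>s x = t y\<close> in
  \<open>M\<close>, then both products begin with one reduced element that is shortened by \<open>s\<close> and by \<open>t\<close>. It is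
  proved along a chain of braid relations. Joining two links of the chain requires a common
  reduced multiple of two reduced divisors of a shorter element. That is provided by
  \<open>upper_bound_below\<close>, by the same statement for shorter elements. Arguing through reduced elements
  avoids any case distinction on triples of generators.
\<close>

section \<open>Words modulo a presentation\<close>

lemma pres_cong_in_lists:
  "pres_cong X R u v \<Longrightarrow> u \<in> lists X \<and> v \<in> lists X"
  by (induction rule: pres_cong.induct) auto

lemma pres_cong_context:
  assumes "pres_cong X R u v" "p \<in> lists X" "q \<in> lists X"
  shows "pres_cong X R (p @ u @ q) (p @ v @ q)"
  using assms
proof (induction rule: pres_cong.induct)
  case (rel l r p' q')
  then have "pres_cong X R ((p @ p') @ l @ (q' @ q)) ((p @ p') @ r @ (q' @ q))"
    by (intro pres_cong.rel) auto
  then show ?case by simp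
next
  case (refl u)
  then show ?case by (intro pres_cong.refl) simp
next
  case (sym u v)
  show ?case by (rule pres_cong.sym[OF sym.IH]) fact+
next
  case (trans u v w)
  show ?case by (rule pres_cong.trans[OF trans.IH]) fact+
qed

lemma pres_cong_append:
  assumes "pres_cong X R u u'" "pres_cong X R v v'"
  shows "pres_cong X R (u @ v) (u' @ v')"
proof -
  have "pres_cong X R ([] @ u @ v) ([] @ u' @ v)"
    using assms pres_cong_in_lists[OF assms(2)] by (intro pres_cong_context) auto
  moreover have "pres_cong X R (u' @ v @ []) (u' @ v' @ [])"
    using assms pres_cong_in_lists[OF assms(1)] by (intro pres_cong_context) auto
  ultimately show ?thesis using pres_cong.trans by fastforce
qed

lemma rev_in_lists [simp]: "rev u \<in> lists X \<longleftrightarrow> u \<in> lists X"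
  by (simp add: lists_eq_set)

lemma pres_cong_rev:
  assumes "pres_cong X R u v"
    and "\<And>l r. (l, r) \<in> R \<Longrightarrow> (rev l, rev r) \<in> R \<or> (rev r, rev l) \<in> R"
  shows "pres_cong X R (rev u) (rev v)"
  using assms(1)
proof (induction rule: pres_cong.induct)
  case (rel l r p q)
  have "pres_cong X R (rev q @ rev l @ rev p) (rev q @ rev r @ rev p)"
  proof -
    have l: "rev l \<in> lists X" "rev r \<in> lists X" "rev p \<in> lists X" "rev q \<in> lists X"
      using rel by auto
    from assms(2)[OF rel(1)] show ?thesis
    proof
      assume "(rev l, rev r) \<in> R"
      then show ?thesis using l by (intro pres_cong.rel)
    next
      assume "(rev r, rev l) \<in> R"
      from pres_cong.sym[OF pres_cong.rel[OF this l(2,1,4,3)]] show ?thesis .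
    qed
  qed
  then show ?case by simp
next
  case (refl u)
  then show ?case by (intro pres_cong.refl) auto
next
  case (sym u v)
  show ?case by (rule pres_cong.sym[OF sym.IH])
next
  case (trans u v w)
  show ?case by (rule pres_cong.trans[OF trans.IH])
qed

lemma word_class_eq_iff:
  "u \<in> lists X \<Longrightarrow> word_class X R u = word_class X R v \<longleftrightarrow> pres_cong X R u v"
  unfolding word_class_def
  by (blast intro: pres_cong.intros)

lemma mem_word_class: "u \<in> lists X \<Longrightarrow> u \<in> word_class X R u"
  by (simp add: word_class_def pres_cong.refl)

lemma pres_monoid_mult:
  assumes "u \<in> lists X" "v \<in> lists X"
  shows "word_class X R u \<otimes>\<^bsub>pres_monoid X R\<^esub> word_class X R v = word_class X R (u @ v)"
proof -
  have c: "word_class X R (u' @ v') = word_class X R (u @ v)"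
    if "u' \<in> word_class X R u" "v' \<in> word_class X R v" for u' v'
  proof -
    have "pres_cong X R (u @ v) (u' @ v')"
      using that by (simp add: word_class_def pres_cong_append)
    then show ?thesis
      using assms word_class_eq_iff[of "u @ v" X R "u' @ v'"] by simp
  qed
  have "(\<Union>u'\<in>word_class X R u. \<Union>v'\<in>word_class X R v. word_class X R (u' @ v'))
      = (\<Union>u'\<in>word_class X R u. \<Union>v'\<in>word_class X R v. word_class X R (u @ v))"
    by (rule SUP_cong[OF HOL.refl SUP_cong[OF HOL.refl c]])
  also have "\<dots> = word_class X R (u @ v)"
    using mem_word_class[OF assms(1), of R] mem_word_class[OF assms(2), of R] by blast
  finally show ?thesis by (simp add: pres_monoid_def)
qed

lemma pres_monoid_one: "\<one>\<^bsub>pres_monoid X R\<^esub> = word_class X R []"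
  by (simp add: pres_monoid_def)

lemma pres_monoid_carrier: "carrier (pres_monoid X R) = word_class X R ` lists X"
  by (simp add: pres_monoid_def)

lemma monoid_pres_monoid: "monoid (pres_monoid X R)"
proof (rule monoidI)
  fix x y z
  assume x: "x \<in> carrier (pres_monoid X R)" and y: "y \<in> carrier (pres_monoid X R)"
  from x y obtain u v where u: "u \<in> lists X" "x = word_class X R u"
    and v: "v \<in> lists X" "y = word_class X R v"
    by (auto simp only: pres_monoid_carrier)
  show "x \<otimes>\<^bsub>pres_monoid X R\<^esub> y \<in> carrier (pres_monoid X R)"
    using u v by (simp only: pres_monoid_mult pres_monoid_carrier) simp
  show "\<one>\<^bsub>pres_monoid X R\<^esub> \<otimes>\<^bsub>pres_monoid X R\<^esub> x = x"
    using u by (simp only: pres_monoid_mult pres_monoid_one lists.Nil append_Nil)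
  show "x \<otimes>\<^bsub>pres_monoid X R\<^esub> \<one>\<^bsub>pres_monoid X R\<^esub> = x"
    using u by (simp only: pres_monoid_mult pres_monoid_one lists.Nil append_Nil2)
  assume "z \<in> carrier (pres_monoid X R)"
  then obtain w where w: "w \<in> lists X" "z = word_class X R w"
    by (auto simp only: pres_monoid_carrier)
  have "u @ v \<in> lists X" "v @ w \<in> lists X" using u v w by auto
  then show "x \<otimes>\<^bsub>pres_monoid X R\<^esub> y \<otimes>\<^bsub>pres_monoid X R\<^esub> z = x \<otimes>\<^bsub>pres_monoid X R\<^esub> (y \<otimes>\<^bsub>pres_monoid X R\<^esub> z)"
    using u v w by (simp only: pres_monoid_mult append_assoc)
qed (simp add: pres_monoid_carrier pres_monoid_one)

lemma mprod_pres_monoid: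
  assumes "us \<in> lists X"
  shows "mprod (pres_monoid X R) (map (\<lambda>x. word_class X R [x]) us) = word_class X R us"
  using assms
proof (induction us)
  case (Cons x us)
  then show ?case
    using pres_monoid_mult[of "[x]" X us R] by (simp add: mprod_def)
qed (simp add: mprod_def pres_monoid_one)

text \<open>
  The relabelling \<open>h\<close> covers two cases at once: in the Artin monoid the generators are the letters
  themselves, in the Coxeter group they are the positive letters only.
\<close>

lemma gen_length_pres_monoid:
  assumes "h ` A \<subseteq> X"
  shows "gen_length (pres_monoid X R) ((\<lambda>a. word_class X R [h a]) ` A) (word_class X R x)
     = (LEAST n. \<exists>w \<in> lists A. length w = n \<and> pres_cong X R (map h w) x)"
proof -
  have *: "(\<exists>us \<in> lists ((\<lambda>a. word_class X R [h a]) ` A). length us = n \<and>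
            mprod (pres_monoid X R) us = word_class X R x)
        \<longleftrightarrow> (\<exists>w \<in> lists A. length w = n \<and> pres_cong X R (map h w) x)" for n
  proof -
    have "mprod (pres_monoid X R) (map (\<lambda>a. word_class X R [h a]) w) = word_class X R x
      \<longleftrightarrow> pres_cong X R (map h w) x" if "w \<in> lists A" for w
    proof -
      have l: "map h w \<in> lists X" using that assms by (auto simp: image_subset_iff)
      show ?thesis
        using mprod_pres_monoid[OF l, of R] word_class_eq_iff[OF l]
        by (simp add: o_def)
    qed
    then show ?thesis
      unfolding lists_image by force
  qed
  show ?thesis unfolding gen_length_def * ..
qed

section \<open>Alternating words\<close>

lemma length_alt_word [simp]: "length (alt_word a b n) = n"
  by (induction a b n rule: alt_word.induct) auto

lemma alt_word_in_lists [simp]: "a \<in> X \<Longrightarrow> b \<in> X \<Longrightarrow> alt_word a b n \<in> lists X"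
  by (induction a b n rule: alt_word.induct) auto

lemma alt_word_snoc: "alt_word a b (Suc n) = alt_word a b n @ [if even n then a else b]"
proof (induction n arbitrary: a b)
  case (Suc n)
  have "alt_word a b (Suc (Suc n)) = a # alt_word b a (Suc n)" by simp
  also have "\<dots> = a # alt_word b a n @ [if even n then b else a]" by (simp only: Suc)
  finally show ?case by simp
qed simp

lemma rev_alt_word: "rev (alt_word a b n) = (if even n then alt_word b a n else alt_word a b n)"
proof (induction n arbitrary: a b)
  case (Suc n)
  have "rev (alt_word a b (Suc n)) = (if even n then a else b) # rev (alt_word a b n)"
    unfolding alt_word_snoc by simp
  then show ?case using Suc by simp
qed simp

lemma alt_word_double:
  "alt_word a b (2 * n) = alt_word a b n @ rev (alt_word b a n)"
proof (induction n arbitrary: a b)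
  case (Suc n)
  have "alt_word a b (2 * Suc n) = a # alt_word b a (2 * n) @ [b]"
    using alt_word_snoc[of b a "2 * n"] by simp
  then show ?case using Suc by simp
qed simp

lemma concat_replicate_pair: "concat (replicate k [a, b]) = alt_word a b (2 * k)"
  by (induction k) auto

section \<open>Dihedral recurrences\<close>

text \<open>
  Let two generators with bond \<open>\<kappa>\<close> carry the values \<open>x\<close> and \<open>y\<close>. When they are fired alternately
  (in the sense of \<open>fire\<close> below), this is the value about to be fired after \<open>n\<close> firings.
  For \<open>\<kappa> = 2 * cos \<theta>\<close> the recursion is that of the Chebyshev polynomials.
\<close>

fun dihedral_seq :: "real \<Rightarrow> real \<Rightarrow> real \<Rightarrow> nat \<Rightarrow> real" where
  "dihedral_seq \<kappa> x y 0 = x"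
| "dihedral_seq \<kappa> x y (Suc 0) = y + \<kappa> * x"
| "dihedral_seq \<kappa> x y (Suc (Suc n)) = \<kappa> * dihedral_seq \<kappa> x y (Suc n) - dihedral_seq \<kappa> x y n"

lemma dihedral_seq_shift:
  "dihedral_seq \<kappa> (y + \<kappa> * x) (- x) n = dihedral_seq \<kappa> x y (Suc n)"
  by (induction \<kappa> x y n rule: dihedral_seq.induct) auto

lemma dihedral_seq_sin:
  assumes "sin \<theta> \<noteq> 0"
  shows "sin \<theta> * dihedral_seq (2 * cos \<theta>) x y n = sin ((real n + 1) * \<theta>) * x + sin (real n * \<theta>) * y"
proof (induction "2 * cos \<theta>" x y n rule: dihedral_seq.induct)
  case (2 x y)
  have "sin (2 * \<theta>) = 2 * sin \<theta> * cos \<theta>" by (rule sin_double)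
  then show ?case by (simp add: algebra_simps)
next
  case (3 x y n)
  have rec: "sin (z + 2 * \<theta>) = 2 * cos \<theta> * sin (z + \<theta>) - sin z" for z
  proof -
    have "sin ((z + \<theta>) + \<theta>) + sin ((z + \<theta>) - \<theta>) = 2 * cos \<theta> * sin (z + \<theta>)"
      by (simp only: sin_add sin_diff) simp
    moreover have "(z + \<theta>) + \<theta> = z + 2 * \<theta>" "(z + \<theta>) - \<theta> = z" by simp_all
    ultimately show ?thesis by (metis eq_diff_eq)
  qed
  have "sin \<theta> * dihedral_seq (2 * cos \<theta>) x y (Suc (Suc n))
      = 2 * cos \<theta> * (sin \<theta> * dihedral_seq (2 * cos \<theta>) x y (Suc n))
        - sin \<theta> * dihedral_seq (2 * cos \<theta>) x y n"
    by (simp add: algebra_simps)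
  also have "\<dots> = (2 * cos \<theta> * sin ((real n + 1) * \<theta> + \<theta>) - sin ((real n + 1) * \<theta>)) * x
      + (2 * cos \<theta> * sin (real n * \<theta> + \<theta>) - sin (real n * \<theta>)) * y"
    unfolding 3 by (simp add: algebra_simps)
  also have "\<dots> = sin ((real n + 1) * \<theta> + 2 * \<theta>) * x + sin (real n * \<theta> + 2 * \<theta>) * y"
    unfolding rec ..
  finally show ?case by (simp add: algebra_simps)
qed simp

lemma sum_sin_step:
  "2 * sin \<theta> * (\<Sum>j<n. sin (2 * real j * \<theta> + c)) = cos (c - \<theta>) - cos (2 * real n * \<theta> + c - \<theta>)"
proof (induction n)
  case (Suc n)
  have "2 * sin \<theta> * sin (2 * real n * \<theta> + c)
      = cos (2 * real n * \<theta> + c - \<theta>) - cos (2 * real n * \<theta> + c + \<theta>)"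
    by (simp only: cos_add cos_diff) simp
  moreover have "2 * real (Suc n) * \<theta> + c - \<theta> = 2 * real n * \<theta> + c + \<theta>"
    by (simp add: algebra_simps)
  ultimately show ?case using Suc by (simp add: algebra_simps)
qed simp

section \<open>Length in the Coxeter group\<close>

locale coxeter_data =
  fixes S :: "'a set" and m :: "'a \<Rightarrow> 'a \<Rightarrow> enat"
  assumes coxeter_matrix: "coxeter_matrix S m"
begin

lemma m_sym: "a \<in> S \<Longrightarrow> b \<in> S \<Longrightarrow> m a b = m b a"
  using coxeter_matrix by (auto simp: coxeter_matrix_def)

lemma m_diag: "a \<in> S \<Longrightarrow> m a a = enat 1"
  using coxeter_matrix by (auto simp: coxeter_matrix_def one_enat_def)

lemma m_ge_2: "a \<in> S \<Longrightarrow> b \<in> S \<Longrightarrow> a \<noteq> b \<Longrightarrow> 2 \<le> m a b"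
  using coxeter_matrix by (auto simp: coxeter_matrix_def)

lemma m_enat_ge_2: "a \<in> S \<Longrightarrow> b \<in> S \<Longrightarrow> a \<noteq> b \<Longrightarrow> m a b = enat k \<Longrightarrow> 2 \<le> k"
  using m_ge_2[of a b] by (simp add: numeral_eq_enat)

definition cox_rels :: "(('a \<times> bool) list \<times> ('a \<times> bool) list) set" where
  "cox_rels = group_relations S (coxeter_relators S m)"

definition pos :: "'a list \<Rightarrow> ('a \<times> bool) list" where
  "pos = map (\<lambda>a. (a, True))"

text \<open>
  Every element of the Coxeter group is represented by a positive word, since the generators are
  involutions. It therefore suffices to compare positive words.
\<close>

definition weq :: "'a list \<Rightarrow> 'a list \<Rightarrow> bool" where
  "weq u v \<longleftrightarrow> pres_cong (S \<times> UNIV) cox_rels (pos u) (pos v)"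

lemma pos_append [simp]: "pos (u @ v) = pos u @ pos v"
  by (simp add: pos_def)

lemma pos_in_lists [simp]: "pos u \<in> lists (S \<times> UNIV) \<longleftrightarrow> u \<in> lists S"
  by (auto simp: pos_def)

lemma cox_rels_cases:
  assumes "(l, r) \<in> cox_rels"
  obtains a b k where "a \<in> S" "b \<in> S" "m a b = enat k" "l = pos (alt_word a b (2 * k))" "r = []"
  | x e where "x \<in> S" "l = [(x, e), (x, \<not> e)]" "r = []"
proof -
  have "pos (concat (replicate k [a, b])) = concat (replicate k [(a, True), (b, True)])" for a b k
    by (simp add: pos_def map_concat)
  then show ?thesis
    using that assms
    by (fastforce simp: cox_rels_def group_relations_def coxeter_relators_def concat_replicate_pair)
qed

lemma weq_in_lists: "weq u v \<Longrightarrow> u \<in> lists S \<and> v \<in> lists S"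
  unfolding weq_def by (metis pres_cong_in_lists pos_in_lists)

lemma weq_refl: "u \<in> lists S \<Longrightarrow> weq u u"
  by (simp add: weq_def pres_cong.refl)

lemma weq_sym: "weq u v \<Longrightarrow> weq v u"
  by (simp add: weq_def pres_cong.sym)

lemma weq_trans [trans]: "weq u v \<Longrightarrow> weq v w \<Longrightarrow> weq u w"
  unfolding weq_def by (rule pres_cong.trans)

lemma weq_append: "weq u u' \<Longrightarrow> weq v v' \<Longrightarrow> weq (u @ v) (u' @ v')"
  unfolding weq_def by (simp add: pres_cong_append)

lemma weq_append_left: "p \<in> lists S \<Longrightarrow> weq u v \<Longrightarrow> weq (p @ u) (p @ v)"
  by (rule weq_append[OF weq_refl])

lemma weq_append_right: "p \<in> lists S \<Longrightarrow> weq u v \<Longrightarrow> weq (u @ p) (v @ p)"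
  by (rule weq_append[OF _ weq_refl])

lemma weq_relator:
  assumes "a \<in> S" "b \<in> S" "m a b = enat k"
  shows "weq (alt_word a b (2 * k)) []"
proof -
  have "pos (alt_word a b (2 * k)) = concat (replicate k [(a, True), (b, True)])"
    by (simp add: pos_def map_concat flip: concat_replicate_pair)
  then have "(pos (alt_word a b (2 * k)), []) \<in> cox_rels"
    using assms by (auto simp: cox_rels_def group_relations_def coxeter_relators_def)
  then have "pres_cong (S \<times> UNIV) cox_rels ([] @ pos (alt_word a b (2 * k)) @ []) ([] @ [] @ [])"
    using assms by (intro pres_cong.rel) auto
  then show ?thesis by (simp add: weq_def pos_def)
qed

lemma weq_square: "a \<in> S \<Longrightarrow> weq [a, a] []"
  using weq_relator[of a a 1] m_diag by (simp add: numeral_2_eq_2)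

lemma weq_append_rev: "w \<in> lists S \<Longrightarrow> weq (w @ rev w) []"
proof (induction w)
  case (Cons a w)
  then have "weq ([a] @ (w @ rev w) @ [a]) ([a] @ [] @ [a])"
    by (intro weq_append weq_refl) auto
  also have "weq \<dots> []" using Cons weq_square by simp
  finally show ?case by simp
qed (simp add: weq_refl)

lemma weq_cancel_left:
  assumes "weq (p @ u) (p @ v)"
  shows "weq u v"
proof -
  have l: "p \<in> lists S" "u \<in> lists S" "v \<in> lists S" "rev p \<in> lists S"
    using weq_in_lists[OF assms] by auto
  have c: "weq (rev p @ p @ w) w" if "w \<in> lists S" for w
    using weq_append_right[OF that weq_append_rev[OF l(4)]] by simp
  have "weq u (rev p @ p @ u)" by (rule weq_sym[OF c[OF l(2)]])
  also have "weq \<dots> (rev p @ p @ v)" by (rule weq_append_left[OF l(4) assms])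
  also have "weq \<dots> v" by (rule c[OF l(3)])
  finally show ?thesis .
qed

text \<open>
  The relator of length \<open>2 * k\<close> is the first alternating word followed by the inverse of the
  second one.
\<close>

lemma weq_braid:
  assumes "a \<in> S" "b \<in> S" "m a b = enat k"
  shows "weq (alt_word a b k) (alt_word b a k)"
proof -
  let ?A = "alt_word a b k" and ?B = "alt_word b a k"
  have "weq (?A @ rev ?B @ ?B) (?A @ [])"
    using assms weq_append_rev[of "rev ?B"] by (intro weq_append_left) simp_all
  from weq_sym[OF this] have "weq ?A ((?A @ rev ?B) @ ?B)" by simp
  also have "weq \<dots> ([] @ ?B)"
    using weq_relator[OF assms] assms by (intro weq_append_right) (auto simp: alt_word_double)
  finally show ?thesis by simp
qed

lemma weq_rev:
  assumes "weq u v"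
  shows "weq (rev u) (rev v)"
proof -
  have "(rev l, rev r) \<in> cox_rels \<or> (rev r, rev l) \<in> cox_rels" if "(l, r) \<in> cox_rels" for l r
    using that
  proof (cases rule: cox_rels_cases)
    case (1 a b k)
    have "rev l = pos (alt_word b a (2 * k))"
      using 1 rev_alt_word[of a b "2 * k"] by (simp add: pos_def rev_map)
    moreover have "pos (alt_word b a (2 * k)) = concat (replicate k [(b, True), (a, True)])"
      by (simp add: pos_def map_concat flip: concat_replicate_pair)
    moreover have "m b a = enat k" using 1 m_sym by metis
    ultimately show ?thesis
      using 1 by (auto simp: cox_rels_def group_relations_def coxeter_relators_def)
  next
    case (2 x e)
    then show ?thesis by (auto simp: cox_rels_def group_relations_def)
  qed
  then show ?thesis
    using pres_cong_rev[OF assms[unfolded weq_def]] by (simp add: weq_def pos_def rev_map)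
qed

text \<open>
  Every relator has even length, so the parity of a word is an invariant of its group element.
\<close>

lemma weq_parity:
  assumes "weq u v"
  shows "even (length u) \<longleftrightarrow> even (length v)"
proof -
  have "even (length x) \<longleftrightarrow> even (length y)" if "pres_cong (S \<times> UNIV) cox_rels x y" for x y
    using that
  proof (induction rule: pres_cong.induct)
    case (rel l r p q)
    then show ?case by (auto elim!: cox_rels_cases simp: pos_def)
  qed auto
  from this[OF assms[unfolded weq_def]] show ?thesis by (simp add: pos_def)
qed

definition wlen :: "'a list \<Rightarrow> nat" where
  "wlen w = (LEAST n. \<exists>v. weq v w \<and> length v = n)"

definition red :: "'a list \<Rightarrow> bool" where
  "red w \<longleftrightarrow> w \<in> lists S \<and> wlen w = length w"

lemma wlen_le: "weq v w \<Longrightarrow> wlen w \<le> length v"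
  unfolding wlen_def by (rule Least_le) blast

lemma wlen_le_length: "w \<in> lists S \<Longrightarrow> wlen w \<le> length w"
  by (simp add: wlen_le weq_refl)

lemma wlen_attained:
  assumes "w \<in> lists S"
  obtains v where "weq v w" "length v = wlen w"
proof -
  have "\<exists>v. weq v w \<and> length v = wlen w"
    unfolding wlen_def by (rule LeastI_ex) (use assms weq_refl in blast)
  then show ?thesis using that by blast
qed

lemma wlen_cong: "weq u v \<Longrightarrow> wlen u = wlen v"
proof -
  have "wlen v \<le> wlen u" if uv: "weq u v" for u v
  proof -
    obtain u' where "weq u' u" "length u' = wlen u"
      using wlen_attained weq_in_lists[OF uv] by blast
    then show ?thesis using wlen_le[OF weq_trans[OF _ uv], of u'] by simp
  qed
  from this[of u v] this[of v u] show "weq u v \<Longrightarrow> wlen u = wlen v"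
    using weq_sym[of u v] by simp
qed

lemma obtain_red:
  assumes "w \<in> lists S"
  obtains v where "weq v w" "red v"
proof -
  obtain v where v: "weq v w" "length v = wlen w" by (rule wlen_attained[OF assms])
  then have "red v" using wlen_cong[OF v(1)] weq_in_lists[OF v(1)] by (simp add: red_def)
  with v(1) show ?thesis by (rule that)
qed

lemma red_in_lists: "red w \<Longrightarrow> w \<in> lists S"
  by (simp add: red_def)

lemma wlen_append_le:
  assumes "u \<in> lists S" "v \<in> lists S"
  shows "wlen (u @ v) \<le> wlen u + length v"
proof -
  obtain u' where "weq u' u" "length u' = wlen u" using wlen_attained assms(1) by blast
  then show ?thesis
    using wlen_le[OF weq_append_right[OF assms(2)], of u' u] by simp
qed

lemma wlen_rev: "w \<in> lists S \<Longrightarrow> wlen (rev w) = wlen w"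
proof -
  have "wlen (rev w) \<le> wlen w" if "w \<in> lists S" for w
  proof -
    obtain v where "weq v w" "length v = wlen w" using wlen_attained \<open>w \<in> lists S\<close> by blast
    then show ?thesis using wlen_le[OF weq_rev, of v w] by simp
  qed
  from this[of w] this[of "rev w"] show "w \<in> lists S \<Longrightarrow> wlen (rev w) = wlen w" by auto
qed

lemma wlen_parity: 
  assumes "w \<in> lists S"
  shows "even (wlen w) \<longleftrightarrow> even (length w)"
proof -
  obtain v where "weq v w" "length v = wlen w" using wlen_attained[OF assms] by blast
  then show ?thesis using weq_parity[of v w] by simp
qed

lemma weq_double: "w \<in> lists S \<Longrightarrow> s \<in> S \<Longrightarrow> weq ((w @ [s]) @ [s]) w"
  using weq_append_left[OF _ weq_square, of w s] by simp

lemma wlen_snoc: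
  assumes "w \<in> lists S" "s \<in> S"
  shows "wlen (w @ [s]) = wlen w + 1 \<or> wlen w = wlen (w @ [s]) + 1"
proof -
  have "wlen (w @ [s]) \<le> wlen w + 1" using wlen_append_le[of w "[s]"] assms by simp
  moreover have "wlen w \<le> wlen (w @ [s]) + 1"
    using wlen_append_le[of "w @ [s]" "[s]"] wlen_cong[OF weq_double[OF assms]] assms by simp
  moreover have "even (wlen (w @ [s])) \<longleftrightarrow> odd (wlen w)"
    using assms by (simp add: wlen_parity)
  moreover have "a \<le> b + 1 \<Longrightarrow> b \<le> a + 1 \<Longrightarrow> (even a \<longleftrightarrow> odd b) \<Longrightarrow> a = b + 1 \<or> b = a + 1"
    for a b :: nat by presburger
  ultimately show ?thesis by metis
qed

lemma red_prefix:
  assumes "red (u @ v)"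
  shows "red u"
  using assms wlen_append_le[of u v] wlen_le_length[of u] by (auto simp: red_def)

lemma red_rev: "red w \<Longrightarrow> red (rev w)"
  by (simp add: red_def wlen_rev)

lemma red_suffix: "red (u @ v) \<Longrightarrow> red v"
  using red_rev[of "u @ v"] red_prefix red_rev[of "rev v"] by simp

lemma red_snoc_iff:
  assumes "red v" "s \<in> S"
  shows "red (v @ [s]) \<longleftrightarrow> wlen v < wlen (v @ [s])"
proof -
  have v: "v \<in> lists S" "wlen v = length v" using assms by (simp_all add: red_def)
  then have "red (v @ [s]) \<longleftrightarrow> wlen (v @ [s]) = wlen v + 1" using assms by (simp add: red_def)
  with wlen_snoc[OF v(1) assms(2)] show ?thesis by linarith
qed

section \<open>Peeling off a dihedral factor\<close>

lemma alt_end_descent: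
  assumes "v \<in> lists S" "c \<in> S" "d \<in> S" "weq w (v @ alt_word c d (Suc k))"
    and "wlen w = wlen v + Suc k"
  shows "wlen (w @ [if even k then c else d]) < wlen w"
proof -
  let ?z = "if even k then c else d"
  have z: "?z \<in> S" using assms by simp
  have "weq (w @ [?z]) (((v @ alt_word c d k) @ [?z]) @ [?z])"
    using weq_append_right[OF _ assms(4), of "[?z]"] z unfolding alt_word_snoc by simp
  also have "weq \<dots> (v @ alt_word c d k)"
    using assms z by (intro weq_double) auto
  finally have "wlen (w @ [?z]) = wlen (v @ alt_word c d k)" by (rule wlen_cong)
  also have "\<dots> \<le> wlen v + k"
    using wlen_append_le[of v "alt_word c d k"] assms(1-3) by simp
  finally have "wlen (w @ [?z]) \<le> wlen v + k" .
  then show ?thesis using assms by simp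
qed

text \<open>
  Descending through \<open>s\<close> and \<open>t\<close> as long as possible reaches an element \<open>v\<close> that both of them
  lengthen. The letters removed on the way alternate, because removing the same letter twice
  would not be a descent, and there are at most \<open>m s t\<close> of them, because the two alternating words
  of that length are equal and so end in either letter.
\<close>

lemma dihedral_decomposition:
  assumes "w \<in> lists S" "s \<in> S" "t \<in> S" "s \<noteq> t"
  shows "\<exists>v c d k. v \<in> lists S \<and> {c, d} = {s, t} \<and> weq w (v @ alt_word c d k) \<and>
      wlen w = wlen v + k \<and> enat k \<le> m s t \<and>
      wlen v < wlen (v @ [s]) \<and> wlen v < wlen (v @ [t])"
  using assms(1)
proof (induction "wlen w" arbitrary: w rule: less_induct)
  case less
  show ?case
  proof (cases "wlen w < wlen (w @ [s]) \<and> wlen w < wlen (w @ [t])")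
    case True
    then show ?thesis
      using less weq_refl
      by (intro exI[of _ w] exI[of _ s] exI[of _ t] exI[of _ 0]) (auto simp: zero_enat_def[symmetric])
  next
    case False
    then obtain x where x: "x \<in> {s, t}" "wlen w = wlen (w @ [x]) + 1"
      using wlen_snoc[OF less(2) assms(2)] wlen_snoc[OF less(2) assms(3)]
      by (metis insertI1 insertI2 less_add_one)
    have xS: "x \<in> S" using x assms by auto
    obtain v c d k where v: "v \<in> lists S" and cd: "{c, d} = {s, t}"
      and eq: "weq (w @ [x]) (v @ alt_word c d k)" and len: "wlen (w @ [x]) = wlen v + k"
      and k: "enat k \<le> m s t" and asc: "wlen v < wlen (v @ [s])" "wlen v < wlen (v @ [t])"
      using less.hyps[of "w @ [x]"] x less.prems xS by auto
    have cdS: "c \<in> S" "d \<in> S" and mcd: "m c d = m s t"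
      using cd assms m_sym[of s t] by (auto simp: doubleton_eq_iff)
    have w: "weq w (v @ alt_word c d k @ [x])"
    proof -
      have "weq w ((w @ [x]) @ [x])" by (rule weq_sym[OF weq_double[OF less.prems xS]])
      also have "weq \<dots> ((v @ alt_word c d k) @ [x])" using eq xS by (intro weq_append_right) auto
      finally show ?thesis by simp
    qed
    have up: "wlen (w @ [x]) < wlen ((w @ [x]) @ [x])"
      using wlen_cong[OF weq_double[OF less.prems xS]] x(2) by simp
    show ?thesis
    proof (cases k)
      case 0
      obtain y where "{x, y} = {s, t}" using x(1) by blast
      moreover have "weq w (v @ alt_word x y 1)" using w 0 by simp
      moreover have "enat 1 \<le> m s t"
        using m_ge_2[OF assms(2-4)] by (metis one_enat_def one_le_numeral order_trans)
      ultimately show ?thesis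
        using v asc len x(2) 0 by (intro exI[of _ v] exI[of _ x] exI[of _ y] exI[of _ 1]) auto
    next
      case (Suc j)
      have x_next: "x = (if even k then c else d)"
      proof (rule ccontr)
        assume "x \<noteq> (if even k then c else d)"
        then have "x = (if even j then c else d)"
          using x(1) cd Suc by (auto simp: doubleton_eq_iff)
        then show False
          using alt_end_descent[OF v cdS, of "w @ [x]" j] eq len Suc up by simp
      qed
      have "enat k \<noteq> m s t"
      proof
        assume "enat k = m s t"
        then have "weq (alt_word c d k) (alt_word d c k)"
          using weq_braid cdS mcd by simp
        then have "weq (w @ [x]) (v @ alt_word d c k)"
          by (intro weq_trans[OF eq] weq_append_left[OF v])
        then have "wlen ((w @ [x]) @ [if even j then d else c]) < wlen (w @ [x])"
          using alt_end_descent[OF v cdS(2,1), of "w @ [x]" j] len Suc by simp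
        moreover have "(if even j then d else c) = x" using x_next Suc by simp
        ultimately show False using up by simp
      qed
      then have "enat (Suc k) \<le> m s t"
        using k by (cases "m s t") auto
      moreover have "weq w (v @ alt_word c d (Suc k))"
        using w x_next by (simp only: alt_word_snoc)
      ultimately show ?thesis
        using v asc len x(2) cd
        by (intro exI[of _ v] exI[of _ c] exI[of _ d] exI[of _ "Suc k"]) auto
    qed
  qed
qed

section \<open>The geometric representation\<close>

text \<open>
  This is \<open>- 2 * B s t\<close> for the usual bilinear form on the root space, with
  \<open>B s t = - cos (pi / m s t)\<close>, read as \<open>- 1\<close> for an infinite bond.
\<close>

definition coef :: "'a \<Rightarrow> 'a \<Rightarrow> real" where
  "coef s t = (if s = t then - 2 else case m s t of enat k \<Rightarrow> 2 * cos (pi / real k) | \<infinity> \<Rightarrow> 2)"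

text \<open>
  A function \<open>f\<close> on the generators stands for the linear form on the root space with these values
  at the simple roots. Firing \<open>s\<close> composes this form with the reflection in the simple root of
  \<open>s\<close>, so \<open>play w f\<close> is the form composed with \<open>w\<close>.
\<close>

definition fire :: "'a \<Rightarrow> ('a \<Rightarrow> real) \<Rightarrow> 'a \<Rightarrow> real" where
  "fire s f = (\<lambda>t. f t + coef s t * f s)"

definition play :: "'a list \<Rightarrow> ('a \<Rightarrow> real) \<Rightarrow> 'a \<Rightarrow> real" where
  "play w f = fold fire w f"

lemma coef_sym: "s \<in> S \<Longrightarrow> t \<in> S \<Longrightarrow> coef s t = coef t s"
  using m_sym by (simp add: coef_def)

lemma play_append: "play (u @ v) f = play v (play u f)"
  by (simp add: play_def)

lemma fire_self: "fire s f s = - f s"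
  by (simp add: fire_def coef_def)

lemma fire_fire: "fire s (fire s f) = f"
  by (rule ext) (simp add: fire_def coef_def)

lemma play_alt_word:
  assumes "a \<in> S" "b \<in> S" "a \<noteq> b"
  shows "play (alt_word a b n) f (if even n then a else b) = dihedral_seq (coef a b) (f a) (f b) n"
  using assms
proof (induction n arbitrary: a b f)
  case (Suc n)
  have "play (alt_word a b (Suc n)) f (if even (Suc n) then a else b)
      = play (alt_word b a n) (fire a f) (if even n then b else a)"
    by (simp add: play_def)
  also have "\<dots> = dihedral_seq (coef b a) (fire a f b) (fire a f a) n"
    using Suc by (intro Suc.IH) auto
  also have "\<dots> = dihedral_seq (coef a b) (f b + coef a b * f a) (- f a) n"
    using Suc.prems coef_sym[of b a] by (simp add: fire_self) (simp add: fire_def)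
  also have "\<dots> = dihedral_seq (coef a b) (f a) (f b) (Suc n)"
    by (rule dihedral_seq_shift)
  finally show ?case .
qed (simp add: play_def)

text \<open>
  Each firing of \<open>a\<close> or \<open>b\<close> adds a multiple of the fired value at every generator, whence the
  two sums.
\<close>

lemma play_double_alt_word:
  assumes "a \<in> S" "b \<in> S" "a \<noteq> b"
  defines "p \<equiv> \<lambda>f. dihedral_seq (coef a b) (f a) (f b)"
  shows "play (alt_word a b (2 * n)) f t
     = f t + coef a t * (\<Sum>j<n. p f (2 * j)) + coef b t * (\<Sum>j<n. p f (2 * j + 1))"
proof (induction n arbitrary: t)
  case 0
  then show ?case by (simp add: play_def)
next
  case (Suc n)
  let ?g = "play (alt_word a b (2 * n)) f"
  have w: "alt_word a b (2 * Suc n) = (alt_word a b (2 * n) @ [a]) @ [b]"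
    using alt_word_snoc[of a b "2 * n"] alt_word_snoc[of a b "Suc (2 * n)"] by simp
  have "play (alt_word a b (2 * Suc n)) f = fire b (fire a ?g)"
    unfolding w play_append by (simp add: play_def)
  moreover have "?g a = p f (2 * n)"
    using play_alt_word[OF assms(1-3), of "2 * n" f] by (simp add: p_def)
  moreover have "fire a ?g b = p f (2 * n + 1)"
    using play_alt_word[OF assms(1-3), of "Suc (2 * n)" f] alt_word_snoc[of a b "2 * n"]
    by (simp add: p_def play_append) (simp add: play_def)
  ultimately show ?case
    using Suc[of t] by (simp only: fire_def[of b]) (simp add: fire_def[of a] distrib_left)
qed

text \<open>
  Firing \<open>a\<close> and \<open>b\<close> alternately \<open>2 * k\<close> times changes the value at \<open>t\<close> by multiples of sums of
  sines over equidistant points of a full period, and these sums vanish.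
\<close>

lemma play_relator:
  assumes "a \<in> S" "b \<in> S" "m a b = enat k"
  shows "play (alt_word a b (2 * k)) f = f"
proof (cases "a = b")
  case True
  then have "k = 1" using assms m_diag by simp
  then show ?thesis using True by (simp add: numeral_2_eq_2 play_def fire_fire)
next
  case False
  define \<theta> where "\<theta> = pi / real k"
  have k: "2 \<le> k" using m_enat_ge_2 assms False by blast
  have "0 < \<theta>" "\<theta> < pi" using k by (auto simp: \<theta>_def field_simps)
  then have s: "sin \<theta> \<noteq> 0" using sin_gt_zero by force
  have period: "2 * real k * \<theta> = 2 * pi" using k by (simp add: \<theta>_def)
  have zero: "(\<Sum>j<k. sin (2 * real j * \<theta> + c)) = 0" for c
  proof -
    have "cos (2 * pi + c - \<theta>) = cos (c - \<theta>)"
      using cos_periodic[of "c - \<theta>"] by (simp add: algebra_simps)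
    then have "2 * sin \<theta> * (\<Sum>j<k. sin (2 * real j * \<theta> + c)) = 0"
      unfolding sum_sin_step period by simp
    then show ?thesis using s by simp
  qed
  have c: "coef a b = 2 * cos \<theta>" using False assms by (simp add: coef_def \<theta>_def)
  have sums: "(\<Sum>j<k. dihedral_seq (coef a b) x y (2 * j + i)) = 0" for x y i
  proof -
    have "sin \<theta> * (\<Sum>j<k. dihedral_seq (coef a b) x y (2 * j + i))
        = (\<Sum>j<k. sin (2 * real j * \<theta> + (real i + 1) * \<theta>) * x + sin (2 * real j * \<theta> + real i * \<theta>) * y)"
      unfolding sum_distrib_left c dihedral_seq_sin[OF s]
      by (intro sum.cong) (simp_all add: algebra_simps)
    also have "\<dots> = 0"
      unfolding sum.distrib sum_distrib_right[symmetric] zero by simp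
    finally show ?thesis using s by simp
  qed
  show ?thesis
    using sums[of "f a" "f b" 0] sums[of "f a" "f b" 1]
    by (intro ext) (simp add: play_double_alt_word[OF assms(1,2) False])
qed

lemma play_weq:
  assumes "weq u v"
  shows "play u f = play v f"
proof -
  have "play (map fst x) f = play (map fst y) f" if "pres_cong (S \<times> UNIV) cox_rels x y" for x y
    using that
  proof (induction arbitrary: f rule: pres_cong.induct)
    case (rel l r p q)
    have "play (map fst l) g = play (map fst r) g" for g
      using rel(1)
    proof (cases rule: cox_rels_cases)
      case (1 a b k)
      then show ?thesis
        using play_relator[of a b k g] by (simp add: pos_def o_def) (simp add: play_def)
    next
      case (2 x e)
      then show ?thesis by (simp add: play_def fire_fire)
    qed
    then show ?case by (simp add: play_append)
  qed auto
  from this[OF assms[unfolded weq_def]] show ?thesis by (simp add: pos_def o_def)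
qed

text \<open>
  While fewer than \<open>m a b\<close> letters have been fired, the angles in the sine formula stay between
  \<open>0\<close> and \<open>pi\<close>. For \<open>m a b = \<infinity>\<close> the sequence grows linearly. This is where the exact order of
  the product of two generators enters.
\<close>

lemma dihedral_seq_pos:
  assumes "a \<in> S" "b \<in> S" "a \<noteq> b" "0 < x" "0 < y" "enat n < m a b"
  shows "0 < dihedral_seq (coef a b) x y n"
proof (cases "m a b")
  case (enat k)
  define \<theta> where "\<theta> = pi / real k"
  have k: "2 \<le> k" "n < k" using m_enat_ge_2 assms enat by auto
  have th: "0 < \<theta>" "\<theta> < pi" using k by (auto simp: \<theta>_def field_simps)
  then have s: "0 < sin \<theta>" using sin_gt_zero by blast
  have c: "coef a b = 2 * cos \<theta>" using assms enat by (simp add: coef_def \<theta>_def)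
  have pos: "0 < sin (real j * \<theta>)" if "0 < j" "j < k" for j
    using that th by (intro sin_gt_zero) (auto simp: \<theta>_def field_simps)
  have n1: "0 \<le> sin ((real n + 1) * \<theta>)"
  proof (intro sin_ge_zero)
    have "(real n + 1) * \<theta> \<le> real k * \<theta>" using k th by (intro mult_right_mono) auto
    then show "(real n + 1) * \<theta> \<le> pi" using k by (simp add: \<theta>_def)
  qed (use th in simp)
  have "0 < sin ((real n + 1) * \<theta>) * x + sin (real n * \<theta>) * y"
  proof (cases "n = 0")
    case True
    then show ?thesis using s assms by simp
  next
    case False
    then show ?thesis
      using pos[of n] k n1 assms by (intro add_nonneg_pos mult_nonneg_nonneg mult_pos_pos) auto
  qed
  then have "0 < sin \<theta> * dihedral_seq (coef a b) x y n"
    unfolding c using s by (subst dihedral_seq_sin) auto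
  then show ?thesis using s by (simp add: zero_less_mult_iff)
next
  case infinity
  then have c: "coef a b = 2" using assms by (simp add: coef_def)
  have "dihedral_seq 2 x y n = (real n + 1) * x + real n * y"
    by (induction "2 :: real" x y n rule: dihedral_seq.induct) (simp_all add: algebra_simps)
  then show ?thesis using c assms by (simp add: add_pos_nonneg)
qed

text \<open>
  As the form with value \<open>1\<close> at all simple roots is used, \<open>root_sign w s\<close> is the sum of the
  coordinates of the image under \<open>w\<close> of the simple root of \<open>s\<close>.
\<close>

definition root_sign :: "'a list \<Rightarrow> 'a \<Rightarrow> real" where
  "root_sign w = play w (\<lambda>_. 1)"

text \<open>
  If \<open>t\<close> shortens \<open>w\<close>, peel off the alternating word in \<open>s\<close> and \<open>t\<close> at the end of \<open>w\<close>. The shorter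
  element \<open>v\<close> that is left is lengthened by both, so both values are positive at \<open>v\<close> by
  induction. The peeled word has fewer than \<open>m s t\<close> letters, as \<open>s\<close> lengthens \<open>w\<close>, and hence the
  value at \<open>s\<close> is still positive after it.
\<close>

lemma root_sign_pos:
  assumes "w \<in> lists S" "s \<in> S" "wlen w < wlen (w @ [s])"
  shows "0 < root_sign w s"
  using assms
proof (induction "wlen w" arbitrary: w s rule: less_induct)
  case less
  show ?case
  proof (cases "\<exists>t\<in>S. wlen (w @ [t]) < wlen w")
    case False
    have "wlen w = 0"
    proof (rule ccontr)
      assume "wlen w \<noteq> 0"
      obtain v where v: "weq v w" "length v = wlen w" using wlen_attained less.prems(1) by blast
      with \<open>wlen w \<noteq> 0\<close> obtain u t where ut: "v = u @ [t]" by (cases v rule: rev_cases) auto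
      then have t: "u \<in> lists S" "t \<in> S" using weq_in_lists[OF v(1)] by auto
      have "weq (w @ [t]) (v @ [t])" using v t weq_sym by (intro weq_append_right) auto
      also have "weq \<dots> u" using ut t weq_double by simp
      finally have "wlen (w @ [t]) \<le> length u" using wlen_le[OF weq_sym] by blast
      then show False using False t v(2) ut by auto
    qed
    then have "weq [] w" using wlen_attained[OF less.prems(1)] by (metis length_0_conv)
    from play_weq[OF this] show ?thesis by (simp add: root_sign_def) (simp add: play_def)
  next
    case True
    then obtain t where t: "t \<in> S" "wlen (w @ [t]) < wlen w" by blast
    then have st: "s \<noteq> t" using less.prems by auto
    obtain v c d k where v: "v \<in> lists S" and cd: "{c, d} = {s, t}"
      and eq: "weq w (v @ alt_word c d k)" and len: "wlen w = wlen v + k"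
      and k: "enat k \<le> m s t" and asc: "wlen v < wlen (v @ [s])" "wlen v < wlen (v @ [t])"
      using dihedral_decomposition[OF less.prems(1,2) t(1) st] by blast
    have cdS: "c \<in> S" "d \<in> S" "c \<noteq> d" and mcd: "m c d = m s t"
      using cd less.prems(2) t(1) st m_sym[of s t] by (auto simp: doubleton_eq_iff)
    have "k \<noteq> 0"
    proof
      assume "k = 0"
      then have "wlen w = wlen v" "wlen (w @ [t]) = wlen (v @ [t])"
        using eq t(1) by (auto intro!: wlen_cong weq_append_right)
      then show False using t(2) asc(2) by simp
    qed
    then obtain j where j: "k = Suc j" by (cases k) auto
    have s: "s = (if even k then c else d)"
    proof (rule ccontr)
      assume "s \<noteq> (if even k then c else d)"
      then have "s = (if even j then c else d)" using cd j by (auto simp: doubleton_eq_iff)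
      then show False
        using alt_end_descent[OF v cdS(1,2), of w j] eq len j less.prems(3) by simp
    qed
    have "enat k \<noteq> m c d"
    proof
      assume "enat k = m c d"
      then have "weq (alt_word c d k) (alt_word d c k)"
        using weq_braid cdS by simp
      then have "weq w (v @ alt_word d c k)"
        by (intro weq_trans[OF eq] weq_append_left[OF v])
      then have "wlen (w @ [if even j then d else c]) < wlen w"
        using alt_end_descent[OF v cdS(2,1), of w j] len j by simp
      moreover have "(if even j then d else c) = s" using s j by simp
      ultimately show False using less.prems(3) by simp
    qed
    then have kl: "enat k < m c d" using k mcd by (simp add: order_less_le)
    have "0 < root_sign v s" "0 < root_sign v t"
      using less.hyps[OF _ v] asc less.prems(2) t(1) len j by auto
    then have "0 < root_sign v c" "0 < root_sign v d" using cd by (auto simp: doubleton_eq_iff)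
    then have "0 < dihedral_seq (coef c d) (root_sign v c) (root_sign v d) k"
      using kl cdS by (intro dihedral_seq_pos)
    also have "\<dots> = play (alt_word c d k) (root_sign v) s"
      using play_alt_word[OF cdS, of k "root_sign v"] s by simp
    also have "\<dots> = root_sign w s"
      using play_weq[OF eq] by (simp add: root_sign_def play_append)
    finally show ?thesis .
  qed
qed

text \<open>
  If \<open>s\<close> shortens \<open>w\<close>, it lengthens \<open>w s\<close>, and passing from \<open>w\<close> to \<open>w s\<close> changes the sign.
\<close>

lemma wlen_less_iff_root_sign:
  assumes "w \<in> lists S" "s \<in> S"
  shows "wlen w < wlen (w @ [s]) \<longleftrightarrow> 0 < root_sign w s"
proof
  assume pos: "0 < root_sign w s"
  show "wlen w < wlen (w @ [s])"
  proof (rule ccontr)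
    assume "\<not> wlen w < wlen (w @ [s])"
    then have "wlen (w @ [s]) < wlen ((w @ [s]) @ [s])"
      using wlen_snoc[OF assms] wlen_cong[OF weq_double[OF assms]] by simp
    then have "0 < root_sign (w @ [s]) s" using assms by (intro root_sign_pos) auto
    moreover have "root_sign (w @ [s]) s = - root_sign w s"
      using fire_self[of s "root_sign w"] by (simp add: root_sign_def play_def)
    ultimately show False using pos by simp
  qed
qed (use assms root_sign_pos in blast)

section \<open>Dihedral cosets and the word problem\<close>

text \<open>
  The dihedral sequence started at the two positive values at \<open>v\<close> stays positive, so every further
  letter lengthens.
\<close>

lemma wlen_append_alt_word:
  assumes "v \<in> lists S" "a \<in> S" "b \<in> S" "a \<noteq> b"
    and "wlen v < wlen (v @ [a])" "wlen v < wlen (v @ [b])" "enat n \<le> m a b"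
  shows "wlen (v @ alt_word a b n) = wlen v + n"
  using assms(7)
proof (induction n)
  case (Suc n)
  let ?z = "if even n then a else b" and ?w = "v @ alt_word a b n"
  have n: "enat n < m a b" using Suc.prems by (metis Suc_ile_eq)
  have w: "?w \<in> lists S" "?z \<in> S" using assms by auto
  have "0 < root_sign v a" "0 < root_sign v b" using assms root_sign_pos by auto
  then have "0 < dihedral_seq (coef a b) (root_sign v a) (root_sign v b) n"
    using n assms by (intro dihedral_seq_pos)
  also have "\<dots> = root_sign ?w ?z"
    using play_alt_word[OF assms(2-4), of n "root_sign v"] by (simp add: root_sign_def play_append)
  finally have "wlen ?w < wlen (?w @ [?z])" using wlen_less_iff_root_sign[OF w] by blast
  then have "wlen (?w @ [?z]) = wlen ?w + 1" using wlen_snoc[OF w] by linarith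
  moreover have "v @ alt_word a b (Suc n) = ?w @ [?z]" by (simp only: alt_word_snoc append_assoc)
  ultimately show ?case using Suc.IH n by simp
qed simp

lemma red_append_alt_word:
  assumes "red (v @ [a])" "red (v @ [b])" "a \<noteq> b" "m a b = enat k"
  shows "red (v @ alt_word a b k)"
proof -
  have v: "red v" "v \<in> lists S" "a \<in> S" "b \<in> S"
    using red_prefix[OF assms(1)] red_in_lists[OF assms(1)] red_in_lists[OF assms(2)] by auto
  have "wlen (v @ alt_word a b k) = wlen v + k"
    using assms v by (intro wlen_append_alt_word) (simp_all flip: red_snoc_iff)
  then show ?thesis using v by (simp add: red_def)
qed

text \<open>
  In the dihedral decomposition of \<open>w\<close>, an alternating factor of fewer than \<open>m a b\<close> letters could
  be prolonged by one of \<open>a\<close> and \<open>b\<close>, which would then lengthen \<open>w\<close>.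
\<close>

lemma two_descents:
  assumes "w \<in> lists S" "a \<in> S" "b \<in> S" "a \<noteq> b"
    and "wlen (w @ [a]) < wlen w" "wlen (w @ [b]) < wlen w"
  shows "\<exists>k v. m a b = enat k \<and> v \<in> lists S \<and> weq w (v @ alt_word a b k) \<and> wlen w = wlen v + k"
proof -
  obtain v c d k where v: "v \<in> lists S" and cd: "{c, d} = {a, b}"
    and eq: "weq w (v @ alt_word c d k)" and len: "wlen w = wlen v + k"
    and k: "enat k \<le> m a b" and asc: "wlen v < wlen (v @ [a])" "wlen v < wlen (v @ [b])"
    using dihedral_decomposition[OF assms(1-4)] by blast
  have cdS: "c \<in> S" "d \<in> S" "c \<noteq> d" and mcd: "m c d = m a b" and cab: "c \<in> {a, b}" "d \<in> {a, b}"
    using cd assms m_sym[of a b] by (auto simp: doubleton_eq_iff)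
  have "\<not> enat k < m c d"
  proof
    assume "enat k < m c d"
    then have "enat (Suc k) \<le> m c d" by (simp add: Suc_ile_eq)
    then have "wlen (v @ alt_word c d (Suc k)) = wlen v + Suc k"
      using v cdS cab asc by (intro wlen_append_alt_word) auto
    moreover have "weq (w @ [if even k then c else d]) (v @ alt_word c d (Suc k))"
      using weq_append_right[OF _ eq, of "[if even k then c else d]"] cdS
      unfolding alt_word_snoc by simp
    ultimately have "wlen (w @ [if even k then c else d]) = Suc (wlen w)"
      using wlen_cong[of "w @ [if even k then c else d]" "v @ alt_word c d (Suc k)"] len by simp
    moreover have "(if even k then c else d) \<in> {a, b}" using cab by simp
    ultimately show False using assms(5,6) by auto
  qed
  then have mk: "m a b = enat k" using k mcd by (simp add: order_le_less)
  have "weq (alt_word c d k) (alt_word a b k)"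
    using cd cdS mk mcd weq_refl weq_braid[of c d k] by (auto simp: doubleton_eq_iff)
  then have "weq w (v @ alt_word a b k)"
    by (intro weq_trans[OF eq] weq_append_left[OF v])
  then show ?thesis using mk v len by blast
qed

text \<open>
  The mirror image of \<open>two_descents\<close>, obtained by reversing words.
\<close>

lemma two_left_descents:
  assumes "red (a # p)" "red (b # q)" "weq (a # p) (b # q)" "a \<noteq> b"
  obtains k h where "m a b = enat k" "red (alt_word a b k @ h)" "weq (a # p) (alt_word a b k @ h)"
proof -
  let ?w = "rev (a # p)"
  have l: "a \<in> S" "b \<in> S" "p \<in> lists S" "q \<in> lists S" using red_in_lists[OF assms(1)] red_in_lists[OF assms(2)] by auto
  have desc: "wlen (?w @ [c]) < wlen ?w" if "weq (c # x) (a # p)" "red (c # x)" "c \<in> S" "x \<in> lists S" for c x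
  proof -
    have "weq (?w @ [c]) ((rev x @ [c]) @ [c])"
      using weq_append_right[OF _ weq_rev[OF weq_sym[OF that(1)]], of "[c]"] that by simp
    also have "weq \<dots> (rev x)" using that weq_double by simp
    finally have "wlen (?w @ [c]) \<le> length x"
      using wlen_le[OF weq_sym, of "?w @ [c]" "rev x"] by simp
    moreover have "wlen ?w = wlen (c # x)"
      using wlen_cong[OF that(1)] wlen_rev[of "a # p"] l by simp
    ultimately show ?thesis using that(2) by (simp add: red_def)
  qed
  have "wlen (?w @ [a]) < wlen ?w" using desc[of a p] weq_refl[of "a # p"] assms l by simp
  moreover have "wlen (?w @ [b]) < wlen ?w" using desc[of b q] weq_sym[OF assms(3)] assms l by simp
  ultimately obtain k v where k: "m a b = enat k" and v: "v \<in> lists S"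
    and eq: "weq ?w (v @ alt_word a b k)" and len: "wlen ?w = wlen v + k"
    using two_descents[of ?w a b] l assms(4) by auto
  obtain h where h: "weq h (rev v)" "red h" using obtain_red v by (metis rev_in_lists)
  have hl: "h \<in> lists S" using h red_in_lists by blast
  have "weq (a # p) (rev (alt_word a b k) @ rev v)" using weq_rev[OF eq] by simp
  also have "weq \<dots> (alt_word a b k @ h)"
    using k l m_sym[of a b] h weq_braid[of b a k] weq_sym weq_refl
    by (intro weq_append) (auto simp: rev_alt_word)
  finally have eq': "weq (a # p) (alt_word a b k @ h)" .
  have "wlen (alt_word a b k @ h) = length (alt_word a b k @ h)"
    using wlen_cong[OF eq'] wlen_cong[OF h(1)] wlen_rev[OF v] wlen_rev[of "a # p"] len h(2) l
    by (simp add: red_def)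
  then have "red (alt_word a b k @ h)" using l hl by (simp add: red_def)
  then show ?thesis using that k eq' by blast
qed

section \<open>Common multiples in the Artin monoid\<close>

definition acong :: "'a list \<Rightarrow> 'a list \<Rightarrow> bool" where
  "acong = pres_cong S (artin_relations S m)"

lemma acong_in_lists: "acong u v \<Longrightarrow> u \<in> lists S \<and> v \<in> lists S"
  unfolding acong_def by (rule pres_cong_in_lists)

lemma acong_refl: "u \<in> lists S \<Longrightarrow> acong u u"
  unfolding acong_def by (rule pres_cong.refl)

lemma acong_sym: "acong u v \<Longrightarrow> acong v u"
  unfolding acong_def by (rule pres_cong.sym)

lemma acong_trans [trans]: "acong u v \<Longrightarrow> acong v w \<Longrightarrow> acong u w"
  unfolding acong_def by (rule pres_cong.trans)

lemma acong_append: "acong u u' \<Longrightarrow> acong v v' \<Longrightarrow> acong (u @ v) (u' @ v')"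
  unfolding acong_def by (rule pres_cong_append)

lemma acong_append_left: "p \<in> lists S \<Longrightarrow> acong u v \<Longrightarrow> acong (p @ u) (p @ v)"
  by (rule acong_append[OF acong_refl])

lemma acong_append_right: "p \<in> lists S \<Longrightarrow> acong u v \<Longrightarrow> acong (u @ p) (v @ p)"
  by (rule acong_append[OF _ acong_refl])

lemma acong_Cons: "a \<in> S \<Longrightarrow> acong u v \<Longrightarrow> acong (a # u) (a # v)"
  using acong_append_left[of "[a]"] by simp

lemma acong_braid:
  assumes "a \<in> S" "b \<in> S" "m a b = enat k"
  shows "acong (alt_word a b k) (alt_word b a k)"
proof -
  have "(alt_word a b k, alt_word b a k) \<in> artin_relations S m"
    using assms by (auto simp: artin_relations_def)
  then have "acong ([] @ alt_word a b k @ []) ([] @ alt_word b a k @ [])"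
    unfolding acong_def using assms by (intro pres_cong.rel) auto
  then show ?thesis by simp
qed

lemma acong_imp_weq_length:
  assumes "acong u v"
  shows "weq u v \<and> length u = length v"
  using assms unfolding acong_def
proof (induction rule: pres_cong.induct)
  case (rel l r p q)
  then obtain a b k where "l = alt_word a b k" "r = alt_word b a k" "a \<in> S" "b \<in> S" "m a b = enat k"
    by (auto simp: artin_relations_def)
  then show ?case
    using rel weq_braid[of a b k] by (auto intro: weq_append_left weq_append_right)
qed (auto intro: weq_refl weq_sym weq_trans)

lemma acong_imp_weq: "acong u v \<Longrightarrow> weq u v"
  using acong_imp_weq_length by blast

lemma acong_length: "acong u v \<Longrightarrow> length u = length v"
  using acong_imp_weq_length by blast

lemma red_acong: "red u \<Longrightarrow> acong u v \<Longrightarrow> red v"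
  using wlen_cong[OF acong_imp_weq, of u v] acong_length[of u v] acong_in_lists[of u v]
  by (auto simp: red_def)

text \<open>
  This is the solution of the word problem by Tits and Matsumoto, so that reduced elements of the
  Artin monoid correspond to elements of the Coxeter group. If the first letters \<open>a\<close> and \<open>b\<close> of
  the two words differ, the element also has a reduced word beginning with the alternating word
  of length \<open>m a b\<close>. By induction both words can be brought to such a form, one beginning with
  \<open>a\<close> and one with \<open>b\<close>, and a single braid relation connects the two forms.
\<close>

lemma weq_imp_acong_of_red:
  assumes "red u" "red v" "weq u v"
  shows "acong u v"
  using assms
proof (induction "length u" arbitrary: u v rule: less_induct)
  case less
  have len: "length u = length v" using wlen_cong[OF less(4)] less(2,3) by (simp add: red_def)
  show ?case
  proof (cases u)
    case Nil
    then show ?thesis using len acong_refl by simp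
  next
    case (Cons a p)
    then obtain b q where v: "v = b # q" using len by (cases v) auto
    have l: "a \<in> S" "b \<in> S" "p \<in> lists S" "q \<in> lists S"
      using red_in_lists[OF less(2)] red_in_lists[OF less(3)] Cons v by auto
    have rp: "red p" "red q"
      using less(2,3) Cons v red_suffix[of "[a]" p] red_suffix[of "[b]" q] by auto
    show ?thesis
    proof (cases "a = b")
      case True
      then have "weq p q" using less(4) Cons v weq_cancel_left[of "[a]" p q] by simp
      then have "acong p q" using less.hyps[of p q] rp Cons by simp
      then show ?thesis using acong_Cons l True Cons v by simp
    next
      case False
      obtain k h where k: "m a b = enat k" and rh: "red (alt_word a b k @ h)"
        and eq: "weq (a # p) (alt_word a b k @ h)"
        using two_left_descents[of a p b q] less(2-4) Cons v False by blast
      have h: "h \<in> lists S" using red_in_lists[OF rh] by simp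
      obtain j where j: "k = Suc j" using m_enat_ge_2[OF l(1,2) False k] by (cases k) auto
      have br: "acong (alt_word a b k @ h) (alt_word b a k @ h)"
        using acong_braid l k h by (intro acong_append_right) auto
      have "weq p (alt_word b a j @ h)"
        using eq j weq_cancel_left[of "[a]" p "alt_word b a j @ h"] by simp
      moreover have "red (alt_word b a j @ h)"
        using rh j red_suffix[of "[a]" "alt_word b a j @ h"] by simp
      ultimately have "acong p (alt_word b a j @ h)"
        using less.hyps[of p] rp Cons by simp
      then have u: "acong u (alt_word a b k @ h)" using acong_Cons l Cons j by simp
      have "weq (b # q) (alt_word b a k @ h)"
        using weq_trans[OF weq_sym[OF less(4)]] weq_trans[OF eq acong_imp_weq[OF br]] Cons v by simp
      then have "weq q (alt_word a b j @ h)"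
        using j weq_cancel_left[of "[b]" q "alt_word a b j @ h"] by simp
      moreover have "red (alt_word a b j @ h)"
        using red_acong[OF rh br] j red_suffix[of "[b]" "alt_word a b j @ h"] by simp
      ultimately have "acong q (alt_word a b j @ h)"
        using less.hyps[of q] rp Cons len v by simp
      then have "acong v (alt_word b a k @ h)" using acong_Cons l v j by simp
      then show ?thesis using u br acong_trans acong_sym by blast
    qed
  qed
qed

definition ldvd :: "'a list \<Rightarrow> 'a list \<Rightarrow> bool" where
  "ldvd u v \<longleftrightarrow> (\<exists>g. acong v (u @ g))"

lemma ldvd_Nil: "v \<in> lists S \<Longrightarrow> ldvd [] v"
  unfolding ldvd_def by (metis append_Nil acong_refl)

lemma acong_imp_ldvd: "acong u v \<Longrightarrow> ldvd u v"
  unfolding ldvd_def by (metis append_Nil2 acong_sym)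

lemma ldvd_refl: "v \<in> lists S \<Longrightarrow> ldvd v v"
  by (intro acong_imp_ldvd acong_refl)

lemma ldvd_trans [trans]:
  assumes "ldvd u v" "ldvd v w"
  shows "ldvd u w"
proof -
  obtain g h where g: "acong v (u @ g)" and h: "acong w (v @ h)" using assms by (auto simp: ldvd_def)
  then have "acong w ((u @ g) @ h)"
    using acong_in_lists[OF h] by (intro acong_trans[OF h] acong_append_right) auto
  then show ?thesis unfolding ldvd_def by auto
qed

lemma ldvd_append_left: "p \<in> lists S \<Longrightarrow> ldvd u v \<Longrightarrow> ldvd (p @ u) (p @ v)"
  unfolding ldvd_def using acong_append_left by fastforce

lemma ldvd_Cons: "a \<in> S \<Longrightarrow> ldvd u v \<Longrightarrow> ldvd (a # u) (a # v)"
  using ldvd_append_left[of "[a]"] by simp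

lemma ldvd_in_lists: "ldvd u v \<Longrightarrow> u \<in> lists S \<and> v \<in> lists S"
  unfolding ldvd_def using acong_in_lists by fastforce

text \<open>
  The products \<open>s x\<close> and \<open>t y\<close> both begin with one reduced element, written once with first letter
  \<open>s\<close> and once with first letter \<open>t\<close>, and continue in the same way. For \<open>s = t\<close> this amounts to
  cancellation. For \<open>s \<noteq> t\<close> it makes the alternating word of length \<open>m s t\<close> a divisor of both
  products, by \<open>two_left_descents\<close>.
\<close>

definition joined :: "'a \<Rightarrow> 'a list \<Rightarrow> 'a \<Rightarrow> 'a list \<Rightarrow> bool" where
  "joined s x t y \<longleftrightarrow> (\<exists>p q z. red (s # p) \<and> acong (s # p) (t # q) \<and> acong x (p @ z) \<and> acong y (q @ z))"

text \<open>
  The bound \<open>n\<close> makes room for an induction on the length.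
\<close>

definition heads_joined :: "nat \<Rightarrow> bool" where
  "heads_joined n \<longleftrightarrow> (\<forall>s x t y. acong (s # x) (t # y) \<longrightarrow> length x < n \<longrightarrow> joined s x t y)"

lemma cancel_left_below:
  assumes "heads_joined n" "acong (p @ x) (p @ y)" "length (p @ x) \<le> n"
  shows "acong x y"
  using assms(2,3)
proof (induction p)
  case (Cons a p)
  then have "joined a (p @ x) a (p @ y)"
    using assms(1) by (auto simp: heads_joined_def)
  then obtain p' q' z where r: "red (a # p')" and e: "acong (a # p') (a # q')"
    and x: "acong (p @ x) (p' @ z)" and y: "acong (p @ y) (q' @ z)"
    by (auto simp: joined_def)
  have "red p'" "red q'"
    using red_suffix[of "[a]" p'] red_suffix[of "[a]" q'] r red_acong[OF r e] by auto
  moreover have "weq p' q'" using weq_cancel_left[of "[a]" p' q'] acong_imp_weq[OF e] by simp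
  ultimately have "acong p' q'" by (rule weq_imp_acong_of_red)
  then have "acong (p' @ z) (q' @ z)"
    using acong_in_lists[OF x] by (intro acong_append_right) auto
  then have "acong (p @ x) (p @ y)" using x y acong_trans acong_sym by blast
  then show ?case using Cons by simp
qed simp

text \<open>
  The divisors \<open>v\<close> of \<open>z\<close> for which \<open>pre v\<close> is reduced form a directed set. If the two given
  divisors begin with different letters \<open>a\<close> and \<open>b\<close>, then \<open>z\<close> is a multiple of the alternating
  word \<open>D\<close> of length \<open>m a b\<close>, and \<open>pre D\<close> is reduced because \<open>a\<close> and \<open>b\<close> both lengthen \<open>pre\<close>. Each
  divisor has an upper bound in common with \<open>D\<close> by induction, as both begin with the same letter
  (\<open>w1\<close> and \<open>w2\<close> in the proof). These two bounds have the divisor \<open>D\<close> in common, and a further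
  induction joins them.
\<close>

lemma upper_bound_below:
  assumes n: "heads_joined n"
  assumes "length z \<le> n" "red (pre @ v1)" "red (pre @ v2)" "ldvd v1 z" "ldvd v2 z"
  shows "\<exists>v. red (pre @ v) \<and> ldvd v1 v \<and> ldvd v2 v \<and> ldvd v z"
  using assms(2-)
proof (induction "length z" arbitrary: z pre v1 v2 rule: less_induct)
  case less
  note prems = less.prems
  have vl: "v1 \<in> lists S" "v2 \<in> lists S" "z \<in> lists S" "pre \<in> lists S"
    using ldvd_in_lists[OF prems(4)] ldvd_in_lists[OF prems(5)] red_in_lists[OF prems(2)] by auto
  show ?case
  proof (cases "v1 = [] \<or> v2 = []")
    case True
    then show ?thesis using prems vl ldvd_refl ldvd_Nil by metis
  next
    case False
    then obtain a u1 b u2 where v: "v1 = a # u1" "v2 = b # u2"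
      by (meson neq_Nil_conv)
    obtain g1 g2 where g1: "acong z (a # u1 @ g1)" and g2: "acong z (b # u2 @ g2)"
      using prems(4,5) v by (auto simp: ldvd_def)
    let ?x1 = "u1 @ g1" and ?x2 = "u2 @ g2"
    have l: "a \<in> S" "b \<in> S" "?x1 \<in> lists S" "?x2 \<in> lists S" "u1 \<in> lists S" "u2 \<in> lists S"
      using acong_in_lists[OF g1] acong_in_lists[OF g2] by auto
    have len: "length z = Suc (length ?x1)" "length z = Suc (length ?x2)"
      using acong_length[OF g1] acong_length[OF g2] by auto
    have d: "ldvd u1 ?x1" "ldvd u2 ?x2"
      using acong_refl[OF l(3)] acong_refl[OF l(4)] unfolding ldvd_def by auto
    have up: "acong y y'" if "acong z (p @ y)" "acong z (p @ y')" for p y y'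
      using cancel_left_below[OF n, of p y y'] that acong_length[OF that(1)] prems(1)
        acong_trans[OF acong_sym[OF that(1)] that(2)] by simp
    show ?thesis
    proof (cases "a = b")
      case True
      have "acong ?x1 ?x2" using up[of "[a]" ?x1 ?x2] g1 g2 True by simp
      then have "ldvd u2 ?x1" using ldvd_trans[OF d(2)] acong_imp_ldvd acong_sym by blast
      then obtain v where "red ((pre @ [a]) @ v)" "ldvd u1 v" "ldvd u2 v" "ldvd v ?x1"
        using less.hyps[of ?x1 "pre @ [a]" u1 u2] prems v True len d by auto
      moreover have "ldvd (a # ?x1) z" using acong_imp_ldvd[OF acong_sym[OF g1]] by simp
      ultimately show ?thesis
        using v True ldvd_Cons l(1) ldvd_trans
        by (intro exI[of _ "a # v"]) (auto, metis)
    next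
      case False
      have "acong (a # ?x1) (b # ?x2)" using acong_trans[OF acong_sym[OF g1] g2] .
      then have "joined a ?x1 b ?x2"
        using n len prems(1) unfolding heads_joined_def by auto
      then obtain p q w where r: "red (a # p)" and pq: "acong (a # p) (b # q)"
        and x1: "acong ?x1 (p @ w)" by (auto simp: joined_def)
      obtain k h where k: "m a b = enat k" and rh: "red (alt_word a b k @ h)"
        and eq: "weq (a # p) (alt_word a b k @ h)"
        using two_left_descents[OF r red_acong[OF r pq] acong_imp_weq[OF pq] False] by blast
      obtain j where j: "k = Suc j" using m_enat_ge_2[OF l(1,2) False k] by (cases k) auto
      have wl: "w \<in> lists S" "h \<in> lists S"
        using acong_in_lists[OF x1] red_in_lists[OF rh] by auto
      let ?D = "alt_word a b k" and ?y = "h @ w"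
      have Dl: "?D \<in> lists S" using l by simp
      have "acong z ((a # p) @ w)" using acong_trans[OF g1 acong_Cons[OF l(1) x1]] by simp
      also have "acong ((a # p) @ w) ((?D @ h) @ w)"
        using weq_imp_acong_of_red[OF r rh eq] wl by (intro acong_append_right)
      finally have zD: "acong z (?D @ ?y)" by simp
      have br: "acong (?D @ y) (alt_word b a k @ y)" if "y \<in> lists S" for y
        using that acong_braid l k by (intro acong_append_right) auto
      have zD': "acong z (alt_word b a k @ ?y)"
        using acong_trans[OF zD br] wl by simp
      have e1: "acong ?x1 (alt_word b a j @ ?y)" using up[of "[a]"] g1 zD j by simp
      have e2: "acong ?x2 (alt_word a b j @ ?y)" using up[of "[b]"] g2 zD' j by simp
      have ra: "red (pre @ [a])" "red (pre @ [b])"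
        using prems(2,3) v red_prefix[of "pre @ [a]" u1] red_prefix[of "pre @ [b]" u2] by auto
      have "red (pre @ alt_word a b k)" "red (pre @ alt_word b a k)"
        using red_append_alt_word ra False k m_sym[OF l(1,2)] by metis+
      moreover have "ldvd (alt_word b a j) ?x1" "ldvd (alt_word a b j) ?x2"
        using e1 e2 unfolding ldvd_def by blast+
      ultimately obtain w1 w2
        where w1: "red ((pre @ [a]) @ w1)" "ldvd u1 w1" "ldvd (alt_word b a j) w1" "ldvd w1 ?x1"
          and w2: "red ((pre @ [b]) @ w2)" "ldvd u2 w2" "ldvd (alt_word a b j) w2" "ldvd w2 ?x2"
        using less.hyps[of ?x1 "pre @ [a]" u1 "alt_word b a j"]
          less.hyps[of ?x2 "pre @ [b]" u2 "alt_word a b j"] prems v len d j by auto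
      obtain h1 where h1: "acong w1 (alt_word b a j @ h1)" using w1(3) by (auto simp: ldvd_def)
      obtain h2 where h2: "acong w2 (alt_word a b j @ h2)" using w2(3) by (auto simp: ldvd_def)
      have hl: "h1 \<in> lists S" "h2 \<in> lists S" using acong_in_lists[OF h1] acong_in_lists[OF h2] by auto
      have a1: "acong (a # w1) (?D @ h1)" using acong_Cons[OF l(1) h1] j by simp
      have "acong (b # w2) (alt_word b a k @ h2)" using acong_Cons[OF l(2) h2] j by simp
      then have a2: "acong (b # w2) (?D @ h2)" using br[OF hl(2)] acong_trans acong_sym by blast
      \<comment> \<open>\<open>h1\<close> and \<open>h2\<close> are the quotients by \<open>D\<close> of the two upper bounds; they divide the quotient of \<open>z\<close>\<close>
      have quot: "ldvd c ?y" if q: "acong (s # w) (?D @ c)" "ldvd w x" "acong z (s # x)" "s \<in> S" for c s w x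
      proof -
        obtain g where g: "acong x (w @ g)" using q(2) by (auto simp: ldvd_def)
        have "acong z ((s # w) @ g)" using acong_trans[OF q(3) acong_Cons[OF q(4) g]] by simp
        also have "acong \<dots> ((?D @ c) @ g)"
          using q(1) acong_in_lists[OF g] by (intro acong_append_right) auto
        finally have "acong ?y (c @ g)" using up[of ?D] zD by simp
        then show ?thesis unfolding ldvd_def by blast
      qed
      have "red ((pre @ ?D) @ h1)" "red ((pre @ ?D) @ h2)"
        using red_acong[OF w1(1), of "(pre @ ?D) @ h1"] red_acong[OF w2(1), of "(pre @ ?D) @ h2"]
          acong_append_left[OF vl(4) a1] acong_append_left[OF vl(4) a2] by simp_all
      moreover have "length ?y < length z" using acong_length[OF zD] j by simp
      ultimately obtain y where y: "red ((pre @ ?D) @ y)" "ldvd h1 y" "ldvd h2 y" "ldvd y ?y"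
        using less.hyps[of ?y "pre @ ?D" h1 h2] prems(1) quot[OF a1 w1(4) g1 l(1)]
          quot[OF a2 w2(4) g2 l(2)] by auto
      have "ldvd (a # u1) (?D @ y)"
        using ldvd_trans[OF ldvd_Cons[OF l(1) w1(2)]
            ldvd_trans[OF acong_imp_ldvd[OF a1] ldvd_append_left[OF Dl y(2)]]] .
      moreover have "ldvd (b # u2) (?D @ y)"
        using ldvd_trans[OF ldvd_Cons[OF l(2) w2(2)]
            ldvd_trans[OF acong_imp_ldvd[OF a2] ldvd_append_left[OF Dl y(3)]]] .
      moreover have "ldvd (?D @ y) z"
        using ldvd_trans[OF ldvd_append_left[OF Dl y(4)] acong_imp_ldvd[OF acong_sym[OF zD]]] .
      ultimately show ?thesis using y(1) v by (intro exI[of _ "?D @ y"]) simp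
    qed
  qed
qed

text \<open>
  Both hypotheses provide a reduced element that begins with \<open>r\<close> and divides \<open>r z\<close>. A common
  reduced multiple of the two is shortened by \<open>s\<close> and by \<open>t\<close>.
\<close>

lemma joined_trans:
  assumes n: "heads_joined n" and "length z \<le> n"
    and "joined s x r z" "joined r z t y"
  shows "joined s x t y"
proof -
  obtain p1 q1 z1 where 1: "red (s # p1)" "acong (s # p1) (r # q1)" "acong x (p1 @ z1)" "acong z (q1 @ z1)"
    using assms(3) by (auto simp: joined_def)
  obtain p2 q2 z2 where 2: "red (r # p2)" "acong (r # p2) (t # q2)" "acong z (p2 @ z2)" "acong y (q2 @ z2)"
    using assms(4) by (auto simp: joined_def)
  have "red ([r] @ q1)" "red ([r] @ p2)" using red_acong[OF 1(1,2)] 2(1) by simp_all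
  moreover have "ldvd q1 z" "ldvd p2 z" using 1(4) 2(3) unfolding ldvd_def by blast+
  ultimately obtain v where v: "red ([r] @ v)" "ldvd q1 v" "ldvd p2 v" "ldvd v z"
    using upper_bound_below[OF n assms(2)] by blast
  obtain v1 v2 g where v1: "acong v (q1 @ v1)" and v2: "acong v (p2 @ v2)" and g: "acong z (v @ g)"
    using v by (auto simp: ldvd_def)
  have l: "g \<in> lists S" "v1 \<in> lists S" "v2 \<in> lists S" "r \<in> S" "q1 \<in> lists S" "p1 \<in> lists S"
    "p2 \<in> lists S" "q2 \<in> lists S"
    using acong_in_lists[OF g] acong_in_lists[OF v1] acong_in_lists[OF v2]
      acong_in_lists[OF 1(2)] acong_in_lists[OF 2(2)] by auto
  have cancel: "acong z' (v' @ g)" if "acong z (q @ z')" "acong v (q @ v')" for q z' v'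
  proof -
    have "acong z ((q @ v') @ g)" by (rule acong_trans[OF g acong_append_right[OF l(1) that(2)]])
    then have "acong (q @ z') (q @ v' @ g)"
      using acong_trans[OF acong_sym[OF that(1)]] by simp
    then show ?thesis
      using cancel_left_below[OF n] acong_length[OF that(1)] assms(2) by simp
  qed
  have sp: "acong (s # p1 @ v1) (r # v)"
    using acong_trans[OF acong_append_right[OF l(2) 1(2)]] acong_Cons[OF l(4) acong_sym[OF v1]]
    by simp
  moreover have "acong (r # v) (t # q2 @ v2)"
    using acong_trans[OF acong_Cons[OF l(4) v2]] acong_append_right[OF l(3) 2(2)] by simp
  moreover have "red (s # p1 @ v1)" using red_acong[OF _ acong_sym[OF sp]] v(1) by simp
  moreover have "acong x ((p1 @ v1) @ g)"
    using acong_trans[OF 1(3) acong_append_left[OF l(6) cancel[OF 1(4) v1]]] by simp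
  moreover have "acong y ((q2 @ v2) @ g)"
    using acong_trans[OF 2(4) acong_append_left[OF l(8) cancel[OF 2(3) v2]]] by simp
  ultimately show ?thesis
    unfolding joined_def
    by (intro exI[of _ "p1 @ v1"] exI[of _ "q2 @ v2"] exI[of _ g] conjI acong_trans[OF sp])
qed

lemma red_Nil: "red []"
  using wlen_le_length[of "[]"] by (simp add: red_def)

lemma red_singleton: "s \<in> S \<Longrightarrow> red [s]"
  using wlen_le_length[of "[s]"] wlen_parity[of "[s]"] by (cases "wlen [s]") (auto simp: red_def)

lemma joined_same_head:
  assumes "s \<in> S" "acong x y"
  shows "joined s x s y"
  unfolding joined_def using assms red_singleton[OF assms(1)] acong_refl[of "[s]"] acong_sym
    acong_refl[of x] acong_in_lists
  by (intro exI[of _ "[]"] exI[of _ x]) auto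

lemma joined_sym: "joined s x t y \<Longrightarrow> joined t y s x"
  unfolding joined_def using red_acong acong_sym by blast

text \<open>
  A braid relation applied at the beginning of a word joins its two first letters by the relation
  itself, one applied further on leaves the first letter alone, and chains of relations are
  handled by \<open>joined_trans\<close>.
\<close>

lemma all_heads_joined: "heads_joined n"
proof (induction n)
  case 0
  then show ?case by (simp add: heads_joined_def)
next
  case (Suc n)
  have "joined s x t y"
    if "pres_cong S (artin_relations S m) u v" "u = s # x" "v = t # y" "length x \<le> n" for u v s x t y
    using that
  proof (induction arbitrary: s x t y rule: pres_cong.induct)
    case (refl u)
    then show ?case using joined_same_head[of s x x] acong_refl[of x] by auto
  next
    case (sym u v)
    then have "length (t # y) = length (s # x)"
      using acong_length[of u v] by (simp add: acong_def)
    then show ?case using sym joined_sym by simp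
  next
    case (trans u v w)
    then have len: "length u = length v" using acong_length[of u v] by (simp add: acong_def)
    then obtain r z where "v = r # z" using trans.prems by (cases v) auto
    then show ?case using trans len joined_trans[OF Suc, of z s x r t y] by simp
  next
    case (rel l r p q)
    show ?case
    proof (cases p)
      case (Cons c p')
      have "acong (p' @ l @ q) (p' @ r @ q)"
        unfolding acong_def using rel.hyps Cons by (intro pres_cong.rel) auto
      then show ?thesis using joined_same_head[of s] rel Cons by auto
    next
      case Nil
      obtain a b k where ab: "l = alt_word a b k" "r = alt_word b a k" "a \<in> S" "b \<in> S" "m a b = enat k"
        using rel(1) by (auto simp: artin_relations_def)
      show ?thesis
      proof (cases "a = b")
        case True
        then have "s = t" "x = y" "alt_word a b k @ q = s # x" using rel Nil ab by auto
        moreover have "alt_word a b k @ q \<in> lists S" using ab rel.hyps by simp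
        ultimately show ?thesis using joined_same_head[of s x x] acong_refl[of x] by simp
      next
        case False
        obtain j where j: "k = Suc j" using m_enat_ge_2[OF ab(3,4) False ab(5)] by (cases k) auto
        have "s = a" "t = b" "x = alt_word b a j @ q" "y = alt_word a b j @ q"
          using rel.prems Nil ab j by auto
        moreover have "red (alt_word a b k)"
          using red_append_alt_word[of "[]" a b k] red_singleton ab False by simp
        moreover have "acong (alt_word a b k) (alt_word b a k)" using acong_braid ab by blast
        ultimately show ?thesis
          unfolding joined_def using acong_refl rel.hyps ab j
          by (intro exI[of _ "alt_word b a j"] exI[of _ "alt_word a b j"] exI[of _ q]) auto
      qed
    qed
  qed
  from this[OF _ HOL.refl HOL.refl] show ?case
    unfolding heads_joined_def acong_def less_Suc_eq_le by blast
qed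

lemma acong_cancel_left: "acong (p @ x) (p @ y) \<Longrightarrow> acong x y"
  using cancel_left_below[OF all_heads_joined] by blast

text \<open>
  A directed set of divisors of bounded length has a greatest element.
\<close>

lemma greatest_red_prefix:
  assumes "u \<in> lists S"
  obtains v where "red v" "ldvd v u" "\<And>w. red w \<Longrightarrow> ldvd w u \<Longrightarrow> ldvd w v"
proof -
  let ?P = "\<lambda>v. red v \<and> ldvd v u"
  have bound: "length v \<le> length u" if q: "ldvd v u" for v
  proof -
    obtain g where "acong u (v @ g)" using q by (auto simp: ldvd_def)
    then show ?thesis using acong_length[of u "v @ g"] by simp
  qed
  have "?P []" using red_Nil ldvd_Nil[OF assms] by simp
  moreover have "\<forall>w. ?P w \<longrightarrow> length w < Suc (length u)" using bound by (simp add: less_Suc_eq_le)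
  ultimately have "\<exists>v. ?P v \<and> (\<forall>w. ?P w \<longrightarrow> length w \<le> length v)"
    by (rule ex_has_greatest_nat)
  then obtain v where v: "?P v" and max: "\<And>w. ?P w \<Longrightarrow> length w \<le> length v"
    by auto
  have "ldvd w v" if w: "red w" "ldvd w u" for w
  proof -
    obtain x where x: "red ([] @ x)" "ldvd v x" "ldvd w x" "ldvd x u"
      using upper_bound_below[OF all_heads_joined order.refl, of "[]" v w u] v w by auto
    obtain g where g: "acong x (v @ g)" using x(2) by (auto simp: ldvd_def)
    have "g = []" using max[of x] x acong_length[OF g] by simp
    then show ?thesis using ldvd_trans[OF x(3)] acong_imp_ldvd[OF g] by simp
  qed
  then show ?thesis using that v by blast
qed

section \<open>The greatest reduced divisor\<close>

abbreviation M where "M \<equiv> artin_monoid S m"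

definition cl :: "'a list \<Rightarrow> 'a list set" where
  "cl w = word_class S (artin_relations S m) w"

sublocale M: monoid M
  unfolding artin_monoid_def by (rule monoid_pres_monoid)

lemma cl_eq_iff: "u \<in> lists S \<Longrightarrow> cl u = cl v \<longleftrightarrow> acong u v"
  unfolding cl_def acong_def by (rule word_class_eq_iff)

lemma cl_carrier: "w \<in> lists S \<Longrightarrow> cl w \<in> carrier M"
  by (simp add: artin_monoid_def pres_monoid_carrier cl_def)

lemma carrier_cl:
  assumes "x \<in> carrier M"
  obtains w where "w \<in> lists S" "x = cl w"
  using assms by (auto simp only: artin_monoid_def pres_monoid_carrier cl_def)

lemma cl_append: "u \<in> lists S \<Longrightarrow> v \<in> lists S \<Longrightarrow> cl (u @ v) = cl u \<otimes>\<^bsub>M\<^esub> cl v"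
  unfolding artin_monoid_def cl_def by (rule pres_monoid_mult[symmetric])

lemma cl_Nil: "cl [] = \<one>\<^bsub>M\<^esub>"
  by (simp add: artin_monoid_def pres_monoid_one cl_def)

lemma gen_length_cl:
  assumes "w \<in> lists S"
  shows "gen_length M (artin_gens S m) (cl w) = length w"
proof -
  have "gen_length M (artin_gens S m) (cl w) = (LEAST n. \<exists>v \<in> lists S. length v = n \<and> acong v w)"
    using gen_length_pres_monoid[of id S S "artin_relations S m" w]
    by (simp add: artin_monoid_def artin_gens_def cl_def acong_def)
  also have "\<dots> = length w"
    using assms acong_refl acong_length by (intro Least_equality) auto
  finally show ?thesis .
qed

lemma coxeter_class_eq: "coxeter_class S m w = word_class (S \<times> UNIV) cox_rels (pos w)"
  by (simp add: coxeter_class_def cox_rels_def pos_def)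

lemma gen_length_coxeter_class:
  "gen_length (coxeter_group S m) (coxeter_gens S m) (coxeter_class S m w) = wlen w"
proof -
  have "coxeter_gens S m = (\<lambda>a. word_class (S \<times> UNIV) cox_rels [(a, True)]) ` S"
    by (simp add: coxeter_gens_def coxeter_class_eq pos_def)
  moreover have "coxeter_group S m = pres_monoid (S \<times> UNIV) cox_rels"
    by (simp add: coxeter_group_def pres_group_def cox_rels_def)
  ultimately have "gen_length (coxeter_group S m) (coxeter_gens S m) (coxeter_class S m w)
      = (LEAST n. \<exists>v \<in> lists S. length v = n \<and> weq v w)"
    using gen_length_pres_monoid[of "\<lambda>a. (a, True)" S "S \<times> UNIV" cox_rels "pos w"]
    by (simp add: coxeter_class_eq weq_def image_subset_iff flip: pos_def)
  also have "\<dots> = wlen w"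
    unfolding wlen_def using weq_in_lists by (intro arg_cong[of _ _ Least] ext) blast
  finally show ?thesis .
qed

lemma coxeter_image_cl:
  assumes "w \<in> lists S"
  shows "coxeter_image S m (cl w) = coxeter_class S m w"
proof -
  have "coxeter_class S m v = coxeter_class S m w" if "v \<in> cl w" for v
  proof -
    have "acong w v" using that by (simp add: cl_def word_class_def acong_def)
    then have "weq w v" by (rule acong_imp_weq)
    then show ?thesis
      using assms by (simp add: coxeter_class_eq weq_def word_class_eq_iff[of "pos w"] flip: word_class_eq_iff[of "pos w"])
  qed
  moreover have "w \<in> cl w" using assms by (simp add: cl_def mem_word_class)
  ultimately show ?thesis unfolding coxeter_image_def by blast
qed

lemma cl_in_artin_red: "w \<in> lists S \<Longrightarrow> cl w \<in> artin_red S m \<longleftrightarrow> red w"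
  by (auto simp: artin_red_def cl_carrier gen_length_cl coxeter_image_cl gen_length_coxeter_class red_def)

lemma artin_red_carrier: "x \<in> artin_red S m \<Longrightarrow> x \<in> carrier M"
  by (simp add: artin_red_def)

lemma one_artin_red: "\<one>\<^bsub>M\<^esub> \<in> artin_red S m"
  using cl_in_artin_red[of "[]"] red_Nil by (simp add: cl_Nil)

lemma artin_red_factor:
  assumes "x \<in> carrier M" "y \<in> carrier M" "x \<otimes>\<^bsub>M\<^esub> y \<in> artin_red S m"
  shows "y \<in> artin_red S m"
proof -
  obtain u where u: "u \<in> lists S" "x = cl u" using assms(1) by (rule carrier_cl)
  obtain v where v: "v \<in> lists S" "y = cl v" using assms(2) by (rule carrier_cl)
  then have "red (u @ v)" using assms(3) u cl_in_artin_red[of "u @ v"] by (simp add: cl_append)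
  then show ?thesis using v cl_in_artin_red red_suffix by blast
qed

lemma left_cancel:
  assumes "x \<in> carrier M" "y \<in> carrier M" "z \<in> carrier M" "x \<otimes>\<^bsub>M\<^esub> y = x \<otimes>\<^bsub>M\<^esub> z"
  shows "y = z"
proof -
  obtain u where u: "u \<in> lists S" "x = cl u" using assms(1) by (rule carrier_cl)
  obtain v where v: "v \<in> lists S" "y = cl v" using assms(2) by (rule carrier_cl)
  obtain w where w: "w \<in> lists S" "z = cl w" using assms(3) by (rule carrier_cl)
  have "acong (u @ v) (u @ w)" using assms(4) u v w by (simp add: cl_append flip: cl_eq_iff)
  then show ?thesis using acong_cancel_left v w cl_eq_iff by blast
qed

text \<open>
  The relations of the Artin monoid preserve the length of words, so \<open>mlen\<close> is additive. It drives
  the inductions on elements.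
\<close>

definition mlen :: "'a list set \<Rightarrow> nat" where
  "mlen = gen_length M (artin_gens S m)"

lemma mlen_mult: "x \<in> carrier M \<Longrightarrow> y \<in> carrier M \<Longrightarrow> mlen (x \<otimes>\<^bsub>M\<^esub> y) = mlen x + mlen y"
  by (elim carrier_cl) (simp add: mlen_def gen_length_cl flip: cl_append)

lemma mlen_0_imp_one: "x \<in> carrier M \<Longrightarrow> mlen x = 0 \<Longrightarrow> x = \<one>\<^bsub>M\<^esub>"
  by (elim carrier_cl) (simp add: mlen_def gen_length_cl flip: cl_Nil)

lemma divides_mult: "c \<in> carrier M \<Longrightarrow> x divides\<^bsub>M\<^esub> x \<otimes>\<^bsub>M\<^esub> c"
  by (rule dividesI[OF _ HOL.refl])

lemma divides_antisym:
  assumes "x \<in> carrier M" "x divides\<^bsub>M\<^esub> y" "y divides\<^bsub>M\<^esub> x"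
  shows "x = y"
proof -
  obtain c d where c: "c \<in> carrier M" "y = x \<otimes>\<^bsub>M\<^esub> c" and d: "d \<in> carrier M" "x = y \<otimes>\<^bsub>M\<^esub> d"
    using assms by (auto elim!: dividesE)
  then have "mlen y = mlen x + mlen c" "mlen x = mlen y + mlen d"
    using assms(1) mlen_mult by (metis M.m_closed)+
  then have "c = \<one>\<^bsub>M\<^esub>" using c mlen_0_imp_one by simp
  then show ?thesis using c assms(1) by simp
qed

lemma cl_divides_iff:
  assumes "u \<in> lists S" "v \<in> lists S"
  shows "cl u divides\<^bsub>M\<^esub> cl v \<longleftrightarrow> ldvd u v"
proof
  assume "cl u divides\<^bsub>M\<^esub> cl v"
  then obtain c where "c \<in> carrier M" "cl v = cl u \<otimes>\<^bsub>M\<^esub> c" by (elim dividesE)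
  then obtain w where "w \<in> lists S" "cl v = cl (u @ w)"
    using assms by (elim carrier_cl) (simp add: cl_append)
  then show "ldvd u v" using assms cl_eq_iff unfolding ldvd_def by blast
next
  assume "ldvd u v"
  then obtain w where w: "acong v (u @ w)" by (auto simp: ldvd_def)
  then have "w \<in> lists S" "cl v = cl (u @ w)" using assms cl_eq_iff acong_in_lists[OF w] by auto
  then show "cl u divides\<^bsub>M\<^esub> cl v"
    using assms by (intro dividesI[of "cl w"]) (auto simp: cl_append cl_carrier)
qed

abbreviation \<alpha> where "\<alpha> \<equiv> alpha S m"

lemma alpha_greatest:
  assumes "u \<in> carrier M"
  shows "\<alpha> u \<in> artin_red S m" "\<alpha> u divides\<^bsub>M\<^esub> u"
    "\<And>w. w \<in> artin_red S m \<Longrightarrow> w divides\<^bsub>M\<^esub> u \<Longrightarrow> w divides\<^bsub>M\<^esub> \<alpha> u"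
proof -
  obtain u' where u: "u' \<in> lists S" "u = cl u'" using assms by (rule carrier_cl)
  obtain v' where v': "red v'" "ldvd v' u'" and g: "\<And>w. red w \<Longrightarrow> ldvd w u' \<Longrightarrow> ldvd w v'"
    using greatest_red_prefix[OF u(1)] by blast
  define v where "v = cl v'"
  have v: "v \<in> artin_red S m" "v divides\<^bsub>M\<^esub> u"
    using v' u red_in_lists[OF v'(1)] by (simp_all add: v_def cl_in_artin_red cl_divides_iff)
  have max: "w divides\<^bsub>M\<^esub> v" if w: "w \<in> artin_red S m" "w divides\<^bsub>M\<^esub> u" for w
  proof -
    obtain w' where w': "w' \<in> lists S" "w = cl w'"
      using artin_red_carrier[OF w(1)] by (rule carrier_cl)
    then show ?thesis
      using w u g red_in_lists[OF v'(1)] by (simp add: v_def cl_in_artin_red cl_divides_iff)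
  qed
  have "\<alpha> u = v"
    unfolding alpha_def
  proof (rule the_equality)
    show "v \<in> artin_red S m \<and> v divides\<^bsub>M\<^esub> u \<and>
      (\<forall>w\<in>artin_red S m. w divides\<^bsub>M\<^esub> u \<and> v divides\<^bsub>M\<^esub> w \<longrightarrow> w = v)"
      using v max divides_antisym artin_red_carrier by blast
  next
    fix x
    assume x: "x \<in> artin_red S m \<and> x divides\<^bsub>M\<^esub> u \<and>
      (\<forall>w\<in>artin_red S m. w divides\<^bsub>M\<^esub> u \<and> x divides\<^bsub>M\<^esub> w \<longrightarrow> w = x)"
    then show "x = v" using v max by blast
  qed
  then show "\<alpha> u \<in> artin_red S m" "\<alpha> u divides\<^bsub>M\<^esub> u"
    "\<And>w. w \<in> artin_red S m \<Longrightarrow> w divides\<^bsub>M\<^esub> u \<Longrightarrow> w divides\<^bsub>M\<^esub> \<alpha> u"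
    using v max by auto
qed

lemma alpha_carrier: "u \<in> carrier M \<Longrightarrow> \<alpha> u \<in> carrier M"
  using alpha_greatest(1) artin_red_carrier by blast

lemma alpha_red:
  assumes "u \<in> artin_red S m"
  shows "\<alpha> u = u"
proof -
  have u: "u \<in> carrier M" using assms by (rule artin_red_carrier)
  then have "u divides\<^bsub>M\<^esub> u" by (intro dividesI[of "\<one>\<^bsub>M\<^esub>"]) auto
  then show ?thesis
    using divides_antisym[OF alpha_carrier[OF u]] alpha_greatest[OF u] assms by blast
qed

lemma alpha_eq_one:
  assumes "u \<in> carrier M" "\<alpha> u = \<one>\<^bsub>M\<^esub>"
  shows "u = \<one>\<^bsub>M\<^esub>"
proof -
  obtain w where w: "w \<in> lists S" "u = cl w" using assms(1) by (rule carrier_cl)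
  show ?thesis
  proof (cases w)
    case Nil
    then show ?thesis using w by (simp add: cl_Nil)
  next
    case (Cons a x)
    then have l: "a \<in> S" "x \<in> lists S" using w by auto
    have "ldvd [a] w" using acong_refl[OF w(1)] Cons unfolding ldvd_def by fastforce
    then have "cl [a] divides\<^bsub>M\<^esub> cl []"
      using alpha_greatest(3)[OF assms(1), of "cl [a]"] assms(2) w l red_singleton
      by (simp add: cl_in_artin_red cl_divides_iff cl_Nil)
    then have "ldvd [a] []" using l by (simp add: cl_divides_iff)
    then show ?thesis using acong_length by (fastforce simp: ldvd_def)
  qed
qed

lemma divides_mult_left:
  assumes "x \<in> carrier M" "y \<in> carrier M" "y divides\<^bsub>M\<^esub> z"
  shows "x \<otimes>\<^bsub>M\<^esub> y divides\<^bsub>M\<^esub> x \<otimes>\<^bsub>M\<^esub> z"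
proof -
  obtain c where "c \<in> carrier M" "z = y \<otimes>\<^bsub>M\<^esub> c" using assms(3) by (rule dividesE)
  then show ?thesis
    using divides_mult[of c "x \<otimes>\<^bsub>M\<^esub> y"] assms(1,2) by (simp add: M.m_assoc)
qed

text \<open>
  The generator \<open>s\<close> is a reduced divisor of \<open>s y\<close>, so \<open>\<alpha> (s y)\<close> has the form \<open>s v\<close>. Here \<open>v\<close> is
  reduced and, by cancellation, divides \<open>y\<close>. Hence it divides \<open>\<alpha> y\<close>, and \<open>s v\<close> divides \<open>s (\<alpha> y)\<close>.
\<close>

lemma alpha_gen_mult:
  assumes s: "s \<in> S" and y: "y \<in> carrier M"
  shows "\<alpha> (cl [s] \<otimes>\<^bsub>M\<^esub> y) = \<alpha> (cl [s] \<otimes>\<^bsub>M\<^esub> \<alpha> y)"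
proof -
  let ?g = "cl [s]"
  have g: "?g \<in> carrier M" "?g \<in> artin_red S m"
    using s red_singleton by (simp_all add: cl_carrier cl_in_artin_red)
  have gy: "?g \<otimes>\<^bsub>M\<^esub> y \<in> carrier M" and ay: "\<alpha> y \<in> carrier M" and gay: "?g \<otimes>\<^bsub>M\<^esub> \<alpha> y \<in> carrier M"
    using g y alpha_carrier by auto
  note A = alpha_greatest[OF gy] and B = alpha_greatest[OF gay]
  obtain v where v: "v \<in> carrier M" "\<alpha> (?g \<otimes>\<^bsub>M\<^esub> y) = ?g \<otimes>\<^bsub>M\<^esub> v"
    using A(3)[OF g(2) divides_mult[OF y]] by (rule dividesE)
  then have vr: "v \<in> artin_red S m" using artin_red_factor g A(1) by metis
  obtain c where c: "c \<in> carrier M" "?g \<otimes>\<^bsub>M\<^esub> y = (?g \<otimes>\<^bsub>M\<^esub> v) \<otimes>\<^bsub>M\<^esub> c"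
    using A(2) v by (auto elim: dividesE)
  then have "y = v \<otimes>\<^bsub>M\<^esub> c"
    using left_cancel[OF g(1) y] g v by (simp add: M.m_assoc)
  then have "v divides\<^bsub>M\<^esub> \<alpha> y"
    using alpha_greatest(3)[OF y vr] c divides_mult by simp
  then have "\<alpha> (?g \<otimes>\<^bsub>M\<^esub> y) divides\<^bsub>M\<^esub> \<alpha> (?g \<otimes>\<^bsub>M\<^esub> \<alpha> y)"
    using v divides_mult_left[OF g(1) v(1)] B(3)[OF A(1)] by simp
  moreover have "\<alpha> (?g \<otimes>\<^bsub>M\<^esub> \<alpha> y) divides\<^bsub>M\<^esub> \<alpha> (?g \<otimes>\<^bsub>M\<^esub> y)"
    using A(3)[OF B(1)] M.divides_trans[OF B(2) divides_mult_left[OF g(1) ay alpha_greatest(2)[OF y]]]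
      alpha_carrier[OF gay] by simp
  ultimately show ?thesis using divides_antisym alpha_carrier[OF gy] by blast
qed

lemma alpha_mult:
  assumes "x \<in> carrier M" "y \<in> carrier M"
  shows "\<alpha> (x \<otimes>\<^bsub>M\<^esub> y) = \<alpha> (x \<otimes>\<^bsub>M\<^esub> \<alpha> y)"
proof -
  obtain w where w: "w \<in> lists S" "x = cl w" using assms(1) by (rule carrier_cl)
  have "\<alpha> (cl w \<otimes>\<^bsub>M\<^esub> y) = \<alpha> (cl w \<otimes>\<^bsub>M\<^esub> \<alpha> y)"
    using w(1)
  proof (induction w)
    case Nil
    then show ?case
      using assms(2) alpha_red[OF alpha_greatest(1)] alpha_carrier by (simp add: cl_Nil)
  next
    case (Cons s w)
    then have l: "s \<in> S" "w \<in> lists S" by auto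
    have e: "cl (s # w) \<otimes>\<^bsub>M\<^esub> z = cl [s] \<otimes>\<^bsub>M\<^esub> (cl w \<otimes>\<^bsub>M\<^esub> z)" if "z \<in> carrier M" for z
      using cl_append[of "[s]" w] l that by (simp add: M.m_assoc cl_carrier)
    have c: "cl w \<otimes>\<^bsub>M\<^esub> y \<in> carrier M" "cl w \<otimes>\<^bsub>M\<^esub> \<alpha> y \<in> carrier M"
      using l assms(2) by (simp_all add: cl_carrier alpha_carrier)
    show ?case
      unfolding e[OF assms(2)] e[OF alpha_carrier[OF assms(2)]]
        alpha_gen_mult[OF l(1) c(1)] alpha_gen_mult[OF l(1) c(2)]
      using Cons.IH l by simp
  qed
  then show ?thesis using w by simp
qed

section \<open>Normal forms as sequences\<close>

definition rest :: "'a list set \<Rightarrow> 'a list set" where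
  "rest u = (SOME c. c \<in> carrier M \<and> u = \<alpha> u \<otimes>\<^bsub>M\<^esub> c)"

lemma rest:
  assumes "u \<in> carrier M"
  shows "rest u \<in> carrier M" "\<alpha> u \<otimes>\<^bsub>M\<^esub> rest u = u"
proof -
  have "\<exists>c. c \<in> carrier M \<and> u = \<alpha> u \<otimes>\<^bsub>M\<^esub> c"
    using alpha_greatest(2)[OF assms] by (auto elim: dividesE)
  from someI_ex[OF this] show "rest u \<in> carrier M" "\<alpha> u \<otimes>\<^bsub>M\<^esub> rest u = u"
    unfolding rest_def by auto
qed

lemma rest_eqI:
  assumes "c \<in> carrier M" "u \<in> carrier M" "u = \<alpha> u \<otimes>\<^bsub>M\<^esub> c"
  shows "rest u = c"
proof (rule left_cancel)
  show "\<alpha> u \<otimes>\<^bsub>M\<^esub> rest u = \<alpha> u \<otimes>\<^bsub>M\<^esub> c" using rest(2)[OF assms(2)] assms(3) by simp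
qed (use assms rest alpha_carrier in auto)

lemma alpha_one: "\<alpha> \<one>\<^bsub>M\<^esub> = \<one>\<^bsub>M\<^esub>"
  by (rule alpha_red[OF one_artin_red])

lemma rest_one: "rest \<one>\<^bsub>M\<^esub> = \<one>\<^bsub>M\<^esub>"
  by (rule rest_eqI) (simp_all add: alpha_one)

lemma mlen_rest:
  assumes "u \<in> carrier M" "u \<noteq> \<one>\<^bsub>M\<^esub>"
  shows "mlen (rest u) < mlen u"
proof -
  have "mlen u = mlen (\<alpha> u) + mlen (rest u)"
    using rest[OF assms(1)] mlen_mult[OF alpha_carrier] assms(1) by metis
  moreover have "mlen (\<alpha> u) \<noteq> 0"
    using mlen_0_imp_one[OF alpha_carrier] alpha_eq_one assms by blast
  ultimately show ?thesis by simp
qed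

lemma mprod_simps [simp]:
  "mprod M [] = \<one>\<^bsub>M\<^esub>" "mprod M (a # us) = a \<otimes>\<^bsub>M\<^esub> mprod M us"
  by (simp_all add: mprod_def)

lemma mprod_carrier: "set us \<subseteq> carrier M \<Longrightarrow> mprod M us \<in> carrier M"
  by (induction us) auto

lemma greedy_nf_carrier: "greedy_nf S m us \<Longrightarrow> set us \<subseteq> carrier M"
  unfolding greedy_nf_def using artin_red_carrier by blast

lemma greedy_nf_Cons:
  "greedy_nf S m (a # us) \<longleftrightarrow> a \<in> artin_red S m - {\<one>\<^bsub>M\<^esub>} \<and> a = \<alpha> (a \<otimes>\<^bsub>M\<^esub> mprod M us) \<and> greedy_nf S m us"
  unfolding greedy_nf_def by (auto simp: All_less_Suc2)

lemma ex1_greedy_nf: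
  assumes "u \<in> carrier M"
  shows "\<exists>!us. greedy_nf S m us \<and> mprod M us = u"
  using assms
proof (induction "mlen u" arbitrary: u rule: less_induct)
  case less
  show ?case
  proof (cases "u = \<one>\<^bsub>M\<^esub>")
    case True
    have "us = []" if "greedy_nf S m us" "mprod M us = \<one>\<^bsub>M\<^esub>" for us
      using that alpha_one by (cases us) (auto simp: greedy_nf_Cons)
    then show ?thesis using True by (intro ex1I[of _ "[]"]) (auto simp: greedy_nf_def)
  next
    case False
    obtain vs where vs: "greedy_nf S m vs" "mprod M vs = rest u"
      and uniq: "\<And>ws. greedy_nf S m ws \<Longrightarrow> mprod M ws = rest u \<Longrightarrow> ws = vs"
      using less.hyps[OF mlen_rest[OF less.prems False] rest(1)[OF less.prems]] by blast
    have "\<alpha> u \<noteq> \<one>\<^bsub>M\<^esub>" using alpha_eq_one[OF less.prems] False by blast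
    show ?thesis
    proof (rule ex1I[of _ "\<alpha> u # vs"])
      show "greedy_nf S m (\<alpha> u # vs) \<and> mprod M (\<alpha> u # vs) = u"
        using vs rest(2)[OF less.prems] alpha_greatest(1)[OF less.prems] \<open>\<alpha> u \<noteq> \<one>\<^bsub>M\<^esub>\<close>
        by (simp add: greedy_nf_Cons)
    next
      fix us
      assume us: "greedy_nf S m us \<and> mprod M us = u"
      then obtain a ws where aw: "us = a # ws" using False by (cases us) auto
      have p: "a \<otimes>\<^bsub>M\<^esub> mprod M ws = u" and ws: "greedy_nf S m ws"
        and a: "a = \<alpha> (a \<otimes>\<^bsub>M\<^esub> mprod M ws)"
        using us unfolding aw greedy_nf_Cons mprod_simps by blast+
      have a: "a = \<alpha> u" using a unfolding p .
      have "rest u = mprod M ws"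
        using p[symmetric] a by (intro rest_eqI mprod_carrier[OF greedy_nf_carrier[OF ws]] less.prems) simp
      then have "ws = vs" using uniq[OF ws] by simp
      then show "us = \<alpha> u # vs" unfolding aw a by (rule arg_cong)
    qed
  qed
qed

lemma iota1_eqI:
  assumes "greedy_nf S m us" "mprod M us = u"
  shows "iota1 S m u = us"
proof -
  have u: "u \<in> carrier M" using assms mprod_carrier[OF greedy_nf_carrier] by blast
  have "greedy_nf S m []" by (simp add: greedy_nf_def)
  then have "u = \<one>\<^bsub>M\<^esub> \<Longrightarrow> us = []"
    using ex1_greedy_nf[OF u] assms mprod_simps(1) by blast
  moreover have "(THE us. greedy_nf S m us \<and> mprod M us = u) = us"
    using the1_equality[OF ex1_greedy_nf[OF u]] assms by blast
  ultimately show ?thesis by (simp add: iota1_def)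
qed

lemma iota1:
  assumes "u \<in> carrier M"
  shows "greedy_nf S m (iota1 S m u)" "mprod M (iota1 S m u) = u"
proof -
  obtain us where us: "greedy_nf S m us" "mprod M us = u"
    using ex1_greedy_nf[OF assms] by blast
  then show "greedy_nf S m (iota1 S m u)" "mprod M (iota1 S m u) = u"
    using iota1_eqI[OF us] by simp_all
qed

lemma iota1_one: "iota1 S m \<one>\<^bsub>M\<^esub> = []"
  by (simp add: iota1_def)

lemma iota1_rec:
  assumes "u \<in> carrier M" "u \<noteq> \<one>\<^bsub>M\<^esub>"
  shows "iota1 S m u = \<alpha> u # iota1 S m (rest u)"
proof (rule iota1_eqI)
  have "\<alpha> u \<noteq> \<one>\<^bsub>M\<^esub>" using alpha_eq_one[OF assms(1)] assms(2) by blast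
  then show "greedy_nf S m (\<alpha> u # iota1 S m (rest u))"
    using iota1[OF rest(1)[OF assms(1)]] rest(2)[OF assms(1)] alpha_greatest(1)[OF assms(1)]
    by (simp add: greedy_nf_Cons)
  show "mprod M (\<alpha> u # iota1 S m (rest u)) = u"
    using iota1(2)[OF rest(1)[OF assms(1)]] rest(2)[OF assms(1)] by simp
qed

text \<open>
  The normal form, continued by \<open>1\<close> after its end. On these sequences the recursion through
  \<open>rest\<close> has no exceptional case, as \<open>1\<close> is its own \<open>\<alpha>\<close> and its own \<open>rest\<close>.
\<close>

primrec pad :: "nat \<Rightarrow> 'a list set \<Rightarrow> 'a list set" where
  "pad 0 u = \<alpha> u"
| "pad (Suc i) u = pad i (rest u)"

lemma pad_one: "pad i \<one>\<^bsub>M\<^esub> = \<one>\<^bsub>M\<^esub>"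
  by (induction i) (simp_all add: alpha_one rest_one)

lemma pad_eq:
  "u \<in> carrier M \<Longrightarrow> pad i u = (if i < length (iota1 S m u) then iota1 S m u ! i else \<one>\<^bsub>M\<^esub>)"
proof (induction i arbitrary: u)
  case 0
  then show ?case by (cases "u = \<one>\<^bsub>M\<^esub>") (auto simp: alpha_one iota1_one iota1_rec)
next
  case (Suc i)
  then show ?case
    by (cases "u = \<one>\<^bsub>M\<^esub>") (auto simp: rest_one pad_one iota1_one iota1_rec rest)
qed

lemma pad_artin_red: "u \<in> carrier M \<Longrightarrow> pad i u \<in> artin_red S m"
  by (induction i arbitrary: u) (auto simp: alpha_greatest rest)

definition nf_seq :: "'a completed \<Rightarrow> nat \<Rightarrow> 'a list set" where
  "nf_seq x = (case x of Inl u \<Rightarrow> \<lambda>i. pad i u | Inr f \<Rightarrow> f)"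

lemma nf_seq_simps [simp]: "nf_seq (Inl u) = (\<lambda>i. pad i u)" "nf_seq (Inr f) = f"
  by (simp_all add: nf_seq_def)

text \<open>
  The value \<open>1\<close> is permitted. It forces all later values to be \<open>1\<close>, so these sequences are exactly
  the infinite normal forms and the finite ones continued by \<open>1\<close>.
\<close>

definition greedy_seq :: "(nat \<Rightarrow> 'a list set) \<Rightarrow> bool" where
  "greedy_seq f \<longleftrightarrow> (\<forall>i. f i \<in> artin_red S m \<and> \<alpha> (f i \<otimes>\<^bsub>M\<^esub> f (Suc i)) = f i)"

lemma greedy_seq_carrier: "greedy_seq f \<Longrightarrow> f i \<in> carrier M"
  unfolding greedy_seq_def using artin_red_carrier by blast

lemma greedy_seq_shift: "greedy_seq f \<Longrightarrow> greedy_seq (\<lambda>i. f (i + k))"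
  by (simp add: greedy_seq_def)

lemma greedy_seq_one:
  assumes "greedy_seq f" "f i = \<one>\<^bsub>M\<^esub>" "i \<le> j"
  shows "f j = \<one>\<^bsub>M\<^esub>"
  using assms(3)
proof (induction j rule: dec_induct)
  case (step j)
  have "\<alpha> (f j \<otimes>\<^bsub>M\<^esub> f (Suc j)) = f j" "f (Suc j) \<in> artin_red S m"
    using assms(1) by (auto simp: greedy_seq_def)
  then show ?case using step(3) alpha_red artin_red_carrier by simp
qed (rule assms(2))

lemma greedy_seq_truncate:
  assumes "greedy_seq f"
  shows "greedy_seq (\<lambda>i. if i < n then f i else \<one>\<^bsub>M\<^esub>)"
  unfolding greedy_seq_def
proof (intro allI conjI)
  fix i
  show "(if i < n then f i else \<one>\<^bsub>M\<^esub>) \<in> artin_red S m"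
    using assms one_artin_red by (auto simp: greedy_seq_def)
  show "\<alpha> ((if i < n then f i else \<one>\<^bsub>M\<^esub>) \<otimes>\<^bsub>M\<^esub> (if Suc i < n then f (Suc i) else \<one>\<^bsub>M\<^esub>))
      = (if i < n then f i else \<one>\<^bsub>M\<^esub>)"
    using assms alpha_one greedy_seq_carrier[OF assms, of i] alpha_red[of "f i"]
    by (auto simp: greedy_seq_def)
qed

text \<open>
  Local greediness implies global greediness, because \<open>\<alpha> (f 0 \<otimes> y)\<close> depends on \<open>\<alpha> y\<close> only.
\<close>

lemma pad_mprod:
  assumes "greedy_seq f" "f n = \<one>\<^bsub>M\<^esub>"
  shows "pad i (mprod M (map f [0..<n])) = f i"
  using assms
proof (induction n arbitrary: f i)
  case 0
  then show ?case using greedy_seq_one[of f 0 i] by (simp add: pad_one)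
next
  case (Suc n)
  let ?g = "\<lambda>i. f (Suc i)"
  let ?y = "mprod M (map ?g [0..<n])"
  have g: "greedy_seq ?g" using greedy_seq_shift[OF Suc.prems(1), of 1] by simp
  have IH: "pad i ?y = f (Suc i)" for i using Suc.IH[OF g] Suc.prems(2) by simp
  have y: "?y \<in> carrier M" using greedy_seq_carrier[OF g] by (intro mprod_carrier) auto
  have f0: "f 0 \<in> carrier M" using greedy_seq_carrier[OF Suc.prems(1)] .
  have e: "mprod M (map f [0..<Suc n]) = f 0 \<otimes>\<^bsub>M\<^esub> ?y"
    by (simp add: upt_conv_Cons map_Suc_upt[symmetric] o_def del: upt_Suc)
  have "\<alpha> (f 0 \<otimes>\<^bsub>M\<^esub> ?y) = \<alpha> (f 0 \<otimes>\<^bsub>M\<^esub> f (Suc 0))"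
    using alpha_mult[OF f0 y] IH[of 0] by simp
  also have "\<dots> = f 0" using Suc.prems(1) by (simp add: greedy_seq_def)
  finally have a: "\<alpha> (f 0 \<otimes>\<^bsub>M\<^esub> ?y) = f 0" .
  then have "rest (f 0 \<otimes>\<^bsub>M\<^esub> ?y) = ?y" using f0 y by (intro rest_eqI) auto
  then show ?case unfolding e using a IH by (cases i) auto
qed

lemma greedy_seq_pad:
  assumes "u \<in> carrier M"
  shows "greedy_seq (\<lambda>i. pad i u)"
  unfolding greedy_seq_def
proof (intro allI conjI)
  fix i
  show "pad i u \<in> artin_red S m" using assms by (rule pad_artin_red)
  show "\<alpha> (pad i u \<otimes>\<^bsub>M\<^esub> pad (Suc i) u) = pad i u"
    using assms
  proof (induction i arbitrary: u)
    case 0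
    then show ?case
      using alpha_mult[OF alpha_carrier[OF 0] rest(1)[OF 0]] rest(2)[OF 0] by simp
  next
    case (Suc i)
    then show ?case using Suc.IH[OF rest(1)[OF Suc.prems]] by simp
  qed
qed

lemma greedy_nf_map_imp:
  assumes "\<And>n. greedy_nf S m (map f [0..<n])"
  shows "greedy_seq f"
  unfolding greedy_seq_def
proof (intro allI conjI)
  fix i
  have n: "greedy_nf S m (map f [0..<i + 2])" by (rule assms)
  then have "f i \<in> set (map f [0..<i + 2])" by simp
  then show fi: "f i \<in> artin_red S m" using n unfolding greedy_nf_def by blast
  have "f (Suc i) \<in> set (map f [0..<i + 2])" by simp
  then have fs: "f (Suc i) \<in> carrier M" using greedy_nf_carrier[OF n] by blast
  have "drop i (map f [0..<i + 2]) = [f i, f (Suc i)]"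
    by (simp add: drop_map upt_conv_Cons numeral_2_eq_2)
  moreover have "map f [0..<i + 2] ! i = \<alpha> (mprod M (drop i (map f [0..<i + 2])))"
    using n unfolding greedy_nf_def by simp
  ultimately show "\<alpha> (f i \<otimes>\<^bsub>M\<^esub> f (Suc i)) = f i"
    using fs by (simp add: nth_append)
qed

lemma greedy_nf_map:
  assumes "greedy_seq f" "\<And>i. f i \<noteq> \<one>\<^bsub>M\<^esub>"
  shows "greedy_nf S m (map f [0..<n])"
  unfolding greedy_nf_def
proof (intro conjI allI impI)
  show "set (map f [0..<n]) \<subseteq> artin_red S m - {\<one>\<^bsub>M\<^esub>}"
    using assms by (auto simp: greedy_seq_def)
next
  fix i
  assume "i < length (map f [0..<n])"
  then have i: "i < n" by simp
  let ?g = "\<lambda>j. if j < n - i then f (j + i) else \<one>\<^bsub>M\<^esub>"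
  have "drop i (map f [0..<n]) = map ?g [0..<n - i]"
    by (rule nth_equalityI) (auto simp: add.commute)
  moreover have "pad 0 (mprod M (map ?g [0..<n - i])) = ?g 0"
    using greedy_seq_truncate[OF greedy_seq_shift[OF assms(1)]] by (intro pad_mprod) auto
  ultimately show "map f [0..<n] ! i = \<alpha> (mprod M (drop i (map f [0..<n])))"
    using i by simp
qed

lemma completion_cases:
  assumes "x \<in> artin_completion S m"
  obtains u where "x = Inl u" "u \<in> carrier M"
  | f where "x = Inr f" "greedy_seq f" "\<And>i. f i \<noteq> \<one>\<^bsub>M\<^esub>" 
proof -
  have "greedy_seq f \<and> f i \<noteq> \<one>\<^bsub>M\<^esub>" if f: "f \<in> artin_boundary S m" for f i
  proof -
    have n: "greedy_nf S m (map f [0..<n])" for n using f by (simp add: artin_boundary_def)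
    have "f i \<in> set (map f [0..<Suc i])" by simp
    then show ?thesis using greedy_nf_map_imp[OF n] n[of "Suc i"] unfolding greedy_nf_def by blast
  qed
  then show ?thesis using that assms by (auto simp: artin_completion_def)
qed

lemma Inl_completion [simp]: "Inl u \<in> artin_completion S m \<longleftrightarrow> u \<in> carrier M"
  by (auto simp: artin_completion_def)

lemma greedy_seq_nf_seq: "x \<in> artin_completion S m \<Longrightarrow> greedy_seq (nf_seq x)"
  by (erule completion_cases) (auto intro: greedy_seq_pad)

lemma nf_seq_surj:
  assumes "greedy_seq f"
  obtains x where "x \<in> artin_completion S m" "nf_seq x = f"
proof (cases "\<exists>n. f n = \<one>\<^bsub>M\<^esub>")
  case True
  then obtain n where n: "f n = \<one>\<^bsub>M\<^esub>" by blast
  have "mprod M (map f [0..<n]) \<in> carrier M"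
    using greedy_seq_carrier[OF assms] by (intro mprod_carrier) auto
  then show ?thesis
    using pad_mprod[OF assms n] by (intro that[of "Inl (mprod M (map f [0..<n]))"]) auto
next
  case False
  then have "f \<in> artin_boundary S m" using greedy_nf_map[OF assms] by (simp add: artin_boundary_def)
  then show ?thesis by (intro that[of "Inr f"]) (auto simp: artin_completion_def)
qed

lemma iota1_not_one: "u \<in> carrier M \<Longrightarrow> a \<in> set (iota1 S m u) \<Longrightarrow> a \<noteq> \<one>\<^bsub>M\<^esub>"
  using iota1(1)[of u] by (auto simp: greedy_nf_def)

lemma less_nf_length_iff:
  assumes "x \<in> artin_completion S m"
  shows "enat i < nf_length S m x \<longleftrightarrow> nf_seq x i \<noteq> \<one>\<^bsub>M\<^esub>"
  using assms
proof (cases rule: completion_cases)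
  case (1 u)
  then show ?thesis
    using iota1_not_one[OF 1(2) nth_mem] by (simp add: nf_length_def pad_eq)
qed (simp add: nf_length_def)

lemma map_nf_seq:
  assumes "x \<in> artin_completion S m"
  shows "\<exists>j. map (nf_seq x) [0..<k] = nf_take S m k x @ replicate j \<one>\<^bsub>M\<^esub>
    \<and> (j = 0 \<longleftrightarrow> enat k \<le> nf_length S m x)"
  using assms
proof (cases rule: completion_cases)
  case (1 u)
  let ?l = "iota1 S m u"
  have "map (nf_seq x) [0..<k] = take k ?l @ replicate (k - length ?l) \<one>\<^bsub>M\<^esub>"
    using 1 by (intro nth_equalityI) (auto simp: pad_eq nth_append)
  then show ?thesis using 1 by (intro exI[of _ "k - length ?l"]) (auto simp: nf_take_def nf_length_def)
qed (simp add: nf_take_def nf_length_def)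

lemma nf_take_not_one:
  assumes "x \<in> artin_completion S m" "a \<in> set (nf_take S m k x)"
  shows "a \<noteq> \<one>\<^bsub>M\<^esub>"
  using assms(1)
proof (cases rule: completion_cases)
  case (1 u)
  then show ?thesis using assms(2) iota1_not_one[of u a] by (auto simp: nf_take_def dest: in_set_takeD)
next
  case (2 f)
  then show ?thesis using assms(2) by (auto simp: nf_take_def)
qed

lemma nf_take_eq:
  assumes "x \<in> artin_completion S m"
  shows "nf_take S m k x = takeWhile (\<lambda>a. a \<noteq> \<one>\<^bsub>M\<^esub>) (map (nf_seq x) [0..<k])"
proof -
  obtain j where j: "map (nf_seq x) [0..<k] = nf_take S m k x @ replicate j \<one>\<^bsub>M\<^esub>"
    using map_nf_seq[OF assms] by blast
  show ?thesis
  proof (cases j)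
    case 0
    have "takeWhile (\<lambda>a. a \<noteq> \<one>\<^bsub>M\<^esub>) (nf_take S m k x) = nf_take S m k x"
      unfolding takeWhile_eq_all_conv using nf_take_not_one[OF assms] by blast
    then show ?thesis using j 0 by (simp del: takeWhile_eq_all_conv)
  next
    case (Suc l)
    then show ?thesis using j nf_take_not_one[OF assms] by (simp add: takeWhile_append2)
  qed
qed

lemma nf_take_cong:
  assumes "x \<in> artin_completion S m" "y \<in> artin_completion S m" "\<forall>i<k. nf_seq x i = nf_seq y i"
  shows "nf_take S m k x = nf_take S m k y"
proof -
  have "map (nf_seq x) [0..<k] = map (nf_seq y) [0..<k]" using assms(3) by simp
  then show ?thesis using nf_take_eq[OF assms(1), of k] nf_take_eq[OF assms(2), of k] by metis
qed

lemma mprod_append_ones: "set us \<subseteq> carrier M \<Longrightarrow> mprod M (us @ replicate j \<one>\<^bsub>M\<^esub>) = mprod M us"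
  by (induction us) (induction j, auto)

lemma pad_mprod_nf_take:
  assumes x: "x \<in> artin_completion S m"
  shows "mprod M (nf_take S m k x) \<in> carrier M"
    "pad i (mprod M (nf_take S m k x)) = (if i < k then nf_seq x i else \<one>\<^bsub>M\<^esub>)"
proof -
  let ?g = "\<lambda>i. if i < k then nf_seq x i else \<one>\<^bsub>M\<^esub>"
  note g = greedy_seq_nf_seq[OF x]
  have c: "set (nf_take S m k x) \<subseteq> carrier M"
  proof
    fix a
    assume "a \<in> set (nf_take S m k x)"
    then have "a \<in> set (map (nf_seq x) [0..<k])"
      unfolding nf_take_eq[OF x] using set_takeWhileD by metis
    then show "a \<in> carrier M" using greedy_seq_carrier[OF g] by auto
  qed
  then show "mprod M (nf_take S m k x) \<in> carrier M" by (rule mprod_carrier)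
  obtain j where "map (nf_seq x) [0..<k] = nf_take S m k x @ replicate j \<one>\<^bsub>M\<^esub>"
    using map_nf_seq[OF x] by blast
  moreover have "map (nf_seq x) [0..<k] = map ?g [0..<k]" by simp
  ultimately have "mprod M (nf_take S m k x) = mprod M (map ?g [0..<k])"
    using mprod_append_ones[OF c] by simp
  then show "pad i (mprod M (nf_take S m k x)) = ?g i"
    using pad_mprod[OF greedy_seq_truncate[OF g], of k k i] by simp
qed

lemma mprod_pad:
  assumes "u \<in> carrier M" "v \<in> carrier M" "\<And>i. pad i u = pad i v"
  shows "u = v"
proof -
  let ?k = "max (length (iota1 S m u)) (length (iota1 S m v))"
  have "nf_take S m ?k (Inl u) = nf_take S m ?k (Inl v)"
    using assms by (intro nf_take_cong) auto
  then have "iota1 S m u = iota1 S m v" by (simp add: nf_take_def)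
  then show ?thesis using iota1(2) assms by metis
qed

lemma nf_seq_inj:
  assumes "x \<in> artin_completion S m" "y \<in> artin_completion S m" "nf_seq x = nf_seq y"
  shows "x = y"
proof -
  have fin: "\<exists>i. pad i u = \<one>\<^bsub>M\<^esub>" if "u \<in> carrier M" for u
    using pad_eq[OF that, of "length (iota1 S m u)"] by auto
  show ?thesis
    using assms(1)
  proof (cases rule: completion_cases)
    case x: (1 u)
    show ?thesis
      using assms(2)
    proof (cases rule: completion_cases)
      case (1 v)
      then show ?thesis using x assms(3) mprod_pad[of u v] by (simp add: fun_eq_iff)
    next
      case (2 f)
      then show ?thesis using x assms(3) fin[of u] by (auto simp: fun_eq_iff)
    qed
  next
    case x: (2 f)
    show ?thesis
      using assms(2)
    proof (cases rule: completion_cases)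
      case (1 v)
      then show ?thesis using x assms(3) fin[of v] by (auto simp: fun_eq_iff)
    next
      case (2 f)
      then show ?thesis using x assms(3) by simp
    qed
  qed
qed

section \<open>The metric\<close>

text \<open>
  The definition of \<open>r1\<close> asks both normal forms to have as many terms as are compared. If one of
  them ends earlier, its continuation by \<open>1\<close> differs there from the other one, so comparing the
  continued sequences yields the same number.
\<close>

lemma r1_eq_first_difference:
  assumes x: "x \<in> artin_completion S m" and y: "y \<in> artin_completion S m" and "x \<noteq> y"
  obtains n where "r1 S m x y = enat n" "nf_seq x n \<noteq> nf_seq y n" "\<And>i. i < n \<Longrightarrow> nf_seq x i = nf_seq y i"
proof -
  let ?P = "\<lambda>k. enat k \<le> nf_length S m x \<and> enat k \<le> nf_length S m y \<and> nf_take S m k x = nf_take S m k y"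
  have "\<exists>i. nf_seq x i \<noteq> nf_seq y i" using nf_seq_inj[OF x y] assms(3) by blast
  then obtain n where n: "nf_seq x n \<noteq> nf_seq y n" and below: "\<And>i. i < n \<Longrightarrow> nf_seq x i = nf_seq y i"
    using exists_least_iff[of "\<lambda>i. nf_seq x i \<noteq> nf_seq y i"] by blast
  have "enat n \<le> nf_length S m z" if z: "z = x \<or> z = y" for z
  proof (rule ccontr)
    assume "\<not> enat n \<le> nf_length S m z"
    then obtain l where l: "nf_length S m z = enat l" "l < n" by (cases "nf_length S m z") auto
    have "z \<in> artin_completion S m" using z x y by blast
    then have "nf_seq z l = \<one>\<^bsub>M\<^esub>" using less_nf_length_iff[of z l] l(1) by simp
    then have "nf_seq x l = \<one>\<^bsub>M\<^esub>" "nf_seq y l = \<one>\<^bsub>M\<^esub>" using z below[OF l(2)] by auto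
    then have "nf_seq x n = \<one>\<^bsub>M\<^esub>" "nf_seq y n = \<one>\<^bsub>M\<^esub>"
      using greedy_seq_one[OF greedy_seq_nf_seq[OF x]] greedy_seq_one[OF greedy_seq_nf_seq[OF y]] l(2)
      by (meson less_imp_le)+
    then show False using n by simp
  qed
  then have Pn: "?P n" using below nf_take_cong[OF x y, of n] by blast
  have "k \<le> n" if P: "?P k" for k
  proof -
    have "map (nf_seq x) [0..<k] = map (nf_seq y) [0..<k]"
      using map_nf_seq[OF x, of k] map_nf_seq[OF y, of k] P by auto
    then have "\<forall>i<k. nf_seq x i = nf_seq y i" by (simp add: map_eq_conv)
    then show ?thesis using n not_less by blast
  qed
  with Pn have "Greatest ?P = n" by (rule Greatest_equality)
  then have "r1 S m x y = enat n" using assms(3) by (simp add: r1_def)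
  then show ?thesis using n below by (rule that)
qed

lemma d1_le_iff:
  assumes x: "x \<in> artin_completion S m" and y: "y \<in> artin_completion S m"
  shows "d1 S m x y \<le> (1 / 2) ^ k \<longleftrightarrow> (\<forall>i<k. nf_seq x i = nf_seq y i)"
proof (cases "x = y")
  case True
  then show ?thesis by (simp add: d1_def r1_def)
next
  case False
  obtain n where r: "r1 S m x y = enat n" and n: "nf_seq x n \<noteq> nf_seq y n"
    and below: "\<And>i. i < n \<Longrightarrow> nf_seq x i = nf_seq y i"
    using r1_eq_first_difference[OF x y False] by blast
  have "d1 S m x y \<le> (1 / 2) ^ k \<longleftrightarrow> k \<le> n" using r by (simp add: d1_def)
  also have "\<dots> \<longleftrightarrow> (\<forall>i<k. nf_seq x i = nf_seq y i)"
    using n below by (meson not_less order_less_le_trans)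
  finally show ?thesis .
qed

lemma d1_cases: "d1 S m x y = 0 \<or> (\<exists>k. d1 S m x y = (1 / 2) ^ k)"
  by (cases "r1 S m x y") (auto simp: d1_def)

lemma d1_nonneg: "0 \<le> d1 S m x y"
  using d1_cases[of x y] by auto

lemma d1_commute: "d1 S m x y = d1 S m y x"
  by (simp add: d1_def r1_def conj_commute conj_left_commute eq_commute[of "nf_take S m _ x"] eq_commute[of x y])

lemma d1_eq_0_iff: "d1 S m x y = 0 \<longleftrightarrow> x = y"
  by (auto simp: d1_def r1_def)

lemma d1_ultra:
  assumes "x \<in> artin_completion S m" "y \<in> artin_completion S m" "z \<in> artin_completion S m"
  shows "d1 S m x z \<le> max (d1 S m x y) (d1 S m y z)"
proof -
  have "d1 S m x y = 0 \<or> d1 S m y z = 0 \<or> (\<exists>k. max (d1 S m x y) (d1 S m y z) = (1 / 2) ^ k)"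
    using d1_cases[of x y] d1_cases[of y z] by (auto simp: max_def)
  moreover have "d1 S m x z \<le> (1 / 2) ^ k" if "max (d1 S m x y) (d1 S m y z) = (1 / 2) ^ k" for k
  proof -
    have "d1 S m x y \<le> (1 / 2) ^ k" "d1 S m y z \<le> (1 / 2) ^ k" using that by auto
    then show ?thesis using assms by (simp add: d1_le_iff)
  qed
  ultimately show ?thesis using d1_eq_0_iff[of x y] d1_eq_0_iff[of y z] by auto
qed

sublocale C: Metric_space "artin_completion S m" "d1 S m"
proof
  fix x y z
  assume "x \<in> artin_completion S m" "y \<in> artin_completion S m" "z \<in> artin_completion S m"
  from d1_ultra[OF this] show "d1 S m x z \<le> d1 S m x y + d1 S m y z"
    using d1_nonneg[of x y] d1_nonneg[of y z] by linarith
qed (auto simp: d1_nonneg d1_commute d1_eq_0_iff)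

section \<open>Completeness and extension of maps\<close>

abbreviation agree :: "nat \<Rightarrow> 'a completed \<Rightarrow> 'a completed \<Rightarrow> bool" where
  "agree k x y \<equiv> \<forall>i<k. nf_seq x i = nf_seq y i"

lemma d1_le_d1_iff:
  assumes "x \<in> artin_completion S m" "y \<in> artin_completion S m"
    "x' \<in> artin_completion S m" "y' \<in> artin_completion S m"
  shows "d1 S m x' y' \<le> d1 S m x y \<longleftrightarrow> (\<forall>k. agree k x y \<longrightarrow> agree k x' y')"
proof
  assume le: "d1 S m x' y' \<le> d1 S m x y"
  show "\<forall>k. agree k x y \<longrightarrow> agree k x' y'"
    unfolding d1_le_iff[OF assms(1,2), symmetric] d1_le_iff[OF assms(3,4), symmetric]
    using order_trans[OF le] by blast
next
  assume a: "\<forall>k. agree k x y \<longrightarrow> agree k x' y'"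
  show "d1 S m x' y' \<le> d1 S m x y"
    using d1_cases[of x y]
  proof
    assume "d1 S m x y = 0"
    then have "x = y" by (simp add: d1_eq_0_iff)
    then have "nf_seq x' i = nf_seq y' i" for i using a by blast
    then have "x' = y'" using nf_seq_inj[OF assms(3,4)] by blast
    then show ?thesis using d1_nonneg d1_eq_0_iff by metis
  next
    assume "\<exists>k. d1 S m x y = (1 / 2) ^ k"
    then obtain k where k: "d1 S m x y = (1 / 2) ^ k" by blast
    then have "agree k x y" using d1_le_iff[OF assms(1,2), of k] by simp
    then show ?thesis unfolding k using a d1_le_iff[OF assms(3,4), of k] by blast
  qed
qed

lemma half_power_less:
  assumes "0 < (e :: real)"
  obtains n where "(1 / 2) ^ n < e"
  using real_arch_pow_inv[OF assms, of "1 / 2"] by auto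

text \<open>
  The terms of a Cauchy sequence become constant at every index, and the resulting sequence is
  again greedy because greediness concerns two consecutive terms at a time.
\<close>

lemma mcomplete_completion: "C.mcomplete"
  unfolding C.mcomplete_def
proof (intro allI impI)
  fix \<sigma>
  assume \<sigma>: "C.MCauchy \<sigma>"
  then have mem: "\<sigma> n \<in> artin_completion S m" for n by (auto simp: C.MCauchy_def)
  have "\<exists>N. \<forall>n\<ge>N. agree k (\<sigma> n) (\<sigma> N)" for k
  proof -
    have "(0 :: real) < (1 / 2) ^ k" by simp
    then obtain N where N: "\<And>n n'. N \<le> n \<Longrightarrow> N \<le> n' \<Longrightarrow> d1 S m (\<sigma> n) (\<sigma> n') < (1 / 2) ^ k"
      using \<sigma> unfolding C.MCauchy_def by meson
    have "agree k (\<sigma> n) (\<sigma> N)" if "N \<le> n" for n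
      using d1_le_iff[OF mem[of n] mem[of N], of k] less_imp_le[OF N[OF that order.refl]] by blast
    then show ?thesis by blast
  qed
  then obtain N where N: "\<And>k n. N k \<le> n \<Longrightarrow> agree k (\<sigma> n) (\<sigma> (N k))" by metis
  define f where "f = (\<lambda>i. nf_seq (\<sigma> (N (Suc i))) i)"
  have f: "nf_seq (\<sigma> n) i = f i" if "N (Suc i) \<le> n" for i n
    using N[OF that] by (simp add: f_def)
  have "greedy_seq f"
    unfolding greedy_seq_def
  proof (intro allI)
    fix i
    let ?n = "max (N (Suc i)) (N (Suc (Suc i)))"
    have "nf_seq (\<sigma> ?n) i = f i" "nf_seq (\<sigma> ?n) (Suc i) = f (Suc i)" using f[of i ?n] f[of "Suc i" ?n] by simp_all
    then show "f i \<in> artin_red S m \<and> \<alpha> (f i \<otimes>\<^bsub>M\<^esub> f (Suc i)) = f i"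
      using greedy_seq_nf_seq[OF mem[of ?n]] unfolding greedy_seq_def by metis
  qed
  then obtain x where x: "x \<in> artin_completion S m" "nf_seq x = f" by (rule nf_seq_surj)
  have "\<exists>K. \<forall>n\<ge>K. d1 S m (\<sigma> n) x < \<epsilon>" if "0 < \<epsilon>" for \<epsilon>
  proof -
    obtain k where k: "(1 / 2) ^ k < \<epsilon>" using half_power_less \<open>0 < \<epsilon>\<close> by blast
    let ?K = "Max (insert 0 ((\<lambda>i. N (Suc i)) ` {..<k}))"
    have "d1 S m (\<sigma> n) x \<le> (1 / 2) ^ k" if n: "?K \<le> n" for n
    proof -
      have "N (Suc i) \<le> n" if "i < k" for i using n that by auto
      then show ?thesis using d1_le_iff[OF mem[of n] x(1)] x(2) f by simp
    qed
    then show ?thesis using k order_le_less_trans by blast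
  qed
  then have "limitin C.mtopology \<sigma> x sequentially"
    unfolding C.limit_metric_sequentially using x(1) mem by auto
  then show "\<exists>x. limitin C.mtopology \<sigma> x sequentially" by blast
qed

abbreviation CM where "CM \<equiv> completion_metric S m"

lemma CM_simps [simp]:
  "mspace CM = artin_completion S m" "mdist CM = d1 S m" "mtopology_of CM = C.mtopology"
  "mcomplete_of CM"
  using mcomplete_completion by (simp_all add: completion_metric_def)

lemma d1_fin_simps [simp]:
  "mspace (artin_metric S m) = carrier M" "mdist (artin_metric S m) = d1_fin S m"
proof -
  interpret F: Metric_space "carrier M" "d1_fin S m"
  proof
    fix x y z
    assume "x \<in> carrier M" "y \<in> carrier M" "z \<in> carrier M"
    then show "d1_fin S m x z \<le> d1_fin S m x y + d1_fin S m y z"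
      using C.triangle[of "Inl x" "Inl y" "Inl z"] by (simp add: d1_fin_def)
  qed (auto simp: d1_fin_def d1_nonneg d1_commute d1_eq_0_iff)
  show "mspace (artin_metric S m) = carrier M" "mdist (artin_metric S m) = d1_fin S m"
    by (simp_all add: artin_metric_def)
qed

definition truncation :: "nat \<Rightarrow> 'a completed \<Rightarrow> 'a list set" where
  "truncation k x = mprod M (nf_take S m k x)"

lemma truncation:
  assumes "x \<in> artin_completion S m"
  shows "truncation k x \<in> carrier M" "j \<le> k \<Longrightarrow> agree j x (Inl (truncation k x))"
  using pad_mprod_nf_take[OF assms] by (auto simp: truncation_def)

lemma dense_carrier: "C.mtopology closure_of (Inl ` carrier M) = artin_completion S m"
proof -
  have "\<exists>y\<in>Inl ` carrier M. y \<in> C.mball x r" if "x \<in> artin_completion S m" "0 < r" for x r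
  proof -
    obtain k where k: "(1 / 2) ^ k < r" using half_power_less \<open>0 < r\<close> by blast
    have "d1 S m x (Inl (truncation k x)) \<le> (1 / 2) ^ k"
      using d1_le_iff[OF that(1), of "Inl (truncation k x)" k] truncation[OF that(1), of k] by simp
    then show ?thesis using k truncation(1)[OF that(1)] that(1) by (intro bexI[of _ "Inl (truncation k x)"]) auto
  qed
  then show ?thesis unfolding C.metric_closure_of by blast
qed

text \<open>
  The values on the dense subset \<open>M\<close> determine a continuous map to a Hausdorff space, so the
  definite description in \<open>completion_ext\<close> is justified.
\<close>

lemma completion_ext:
  assumes "uniformly_continuous_map (artin_metric S m) (artin_metric S m) \<phi>"
  shows "continuous_map C.mtopology C.mtopology (completion_ext S m \<phi>)"
    "\<And>u. u \<in> carrier M \<Longrightarrow> completion_ext S m \<phi> (Inl u) = Inl (\<phi> u)"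
proof -
  let ?D = "Inl ` carrier M"
  let ?Q = "\<lambda>\<Phi>. \<Phi> \<in> extensional (artin_completion S m) \<and>
    continuous_map (mtopology_of CM) (mtopology_of CM) \<Phi> \<and> (\<forall>u \<in> carrier M. \<Phi> (Inl u) = Inl (\<phi> u))"
  have "\<exists>\<delta>>0. \<forall>x\<in>?D. \<forall>y\<in>?D. d1 S m y x < \<delta> \<longrightarrow> d1 S m (Inl (\<phi> (projl y))) (Inl (\<phi> (projl x))) < \<epsilon>"
    if "0 < \<epsilon>" for \<epsilon>
  proof -
    obtain \<delta> where "0 < \<delta>" "\<forall>u\<in>carrier M. \<forall>v\<in>carrier M. d1_fin S m v u < \<delta> \<longrightarrow> d1_fin S m (\<phi> v) (\<phi> u) < \<epsilon>"
      using assms \<open>0 < \<epsilon>\<close> by (auto simp: uniformly_continuous_map_def)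
    then show ?thesis by (intro exI[of _ \<delta>]) (simp add: d1_fin_def)
  qed
  moreover have "\<phi> u \<in> carrier M" if "u \<in> carrier M" for u
    using uniformly_continuous_map_funspace[OF assms] that by auto
  moreover have "?D \<inter> artin_completion S m = ?D" by auto
  ultimately have "uniformly_continuous_map (submetric CM ?D) CM (\<lambda>x. Inl (\<phi> (projl x)))"
    unfolding uniformly_continuous_map_def mspace_submetric mdist_submetric CM_simps by auto
  from uniformly_continuous_map_extends_to_closure_of[OF CM_simps(4) this]
  obtain g where g: "uniformly_continuous_map (submetric CM (mtopology_of CM closure_of ?D)) CM g"
    and ext: "\<And>x. x \<in> ?D \<Longrightarrow> g x = Inl (\<phi> (projl x))"
    by blast
  have "submetric CM (artin_completion S m) = CM"
    using submetric_mspace[of CM] by simp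
  then have "continuous_map C.mtopology C.mtopology g"
    using uniformly_continuous_imp_continuous_map[OF g] by (simp add: dense_carrier)
  then have Q: "?Q (restrict g (artin_completion S m))"
    using ext by (auto intro: continuous_map_eq)
  have uniq: "f = h" if "?Q f" "?Q h" for f h
  proof (rule extensionalityI)
    fix x
    assume "x \<in> artin_completion S m"
    then have x: "x \<in> C.mtopology closure_of ?D" by (simp add: dense_carrier)
    have "continuous_map C.mtopology C.mtopology f" "continuous_map C.mtopology C.mtopology h"
      "\<And>y. y \<in> ?D \<Longrightarrow> f y = h y"
      using that by auto
    then show "f x = h x" by (rule forall_in_closure_of_eq[OF x C.Hausdorff_space_mtopology])
  qed (use that in auto)
  have "?Q (completion_ext S m \<phi>)"
    unfolding completion_ext_def by (rule theI[of ?Q, OF Q uniq[OF _ Q]])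
  then show "continuous_map C.mtopology C.mtopology (completion_ext S m \<phi>)"
    "\<And>u. u \<in> carrier M \<Longrightarrow> completion_ext S m \<phi> (Inl u) = Inl (\<phi> u)" by simp_all
qed

section \<open>Contracting endomorphisms\<close>

lemma contraction_on_iff_agree:
  assumes "\<phi> \<in> carrier M \<rightarrow> carrier M"
  shows "contraction_on (carrier M) (d1_fin S m) \<phi> \<longleftrightarrow>
    (\<forall>u\<in>carrier M. \<forall>v\<in>carrier M. \<forall>k. agree k (Inl u) (Inl v) \<longrightarrow> agree k (Inl (\<phi> u)) (Inl (\<phi> v)))"
proof -
  have "d1_fin S m (\<phi> u) (\<phi> v) \<le> d1_fin S m u v \<longleftrightarrow>
      (\<forall>k. agree k (Inl u) (Inl v) \<longrightarrow> agree k (Inl (\<phi> u)) (Inl (\<phi> v)))"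
    if "u \<in> carrier M" "v \<in> carrier M" for u v
    unfolding d1_fin_def using that assms by (intro d1_le_d1_iff) auto
  then show ?thesis using assms by (simp add: contraction_on_def)
qed

lemma uniformly_continuous_of_contraction:
  assumes "contraction_on (carrier M) (d1_fin S m) \<phi>"
  shows "uniformly_continuous_map (artin_metric S m) (artin_metric S m) \<phi>"
  unfolding uniformly_continuous_map_def
proof (intro conjI allI impI)
  show "\<phi> \<in> mspace (artin_metric S m) \<rightarrow> mspace (artin_metric S m)"
    using assms by (simp add: contraction_on_def)
  fix \<epsilon> :: real
  assume "0 < \<epsilon>"
  moreover have "\<forall>x\<in>carrier M. \<forall>y\<in>carrier M. d1_fin S m y x < \<epsilon> \<longrightarrow> d1_fin S m (\<phi> y) (\<phi> x) < \<epsilon>"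
    using assms unfolding contraction_on_def by (meson order_le_less_trans)
  ultimately show "\<exists>\<delta>>0. \<forall>x\<in>mspace (artin_metric S m). \<forall>y\<in>mspace (artin_metric S m).
      mdist (artin_metric S m) y x < \<delta> \<longrightarrow> mdist (artin_metric S m) (\<phi> y) (\<phi> x) < \<epsilon>"
    by (intro exI[of _ \<epsilon>]) simp
qed

text \<open>
  By continuity the extension at \<open>x\<close> agrees in \<open>k\<close> terms with \<open>\<phi>\<close> at some longer truncation of \<open>x\<close>.
  The two truncations agree in \<open>k\<close> terms, hence so do their images.
\<close>

lemma completion_ext_agree_truncation:
  assumes "contraction_on (carrier M) (d1_fin S m) \<phi>" "x \<in> artin_completion S m"
  shows "agree k (completion_ext S m \<phi> x) (Inl (\<phi> (truncation k x)))"
proof -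
  let ?\<Phi> = "completion_ext S m \<phi>"
  note uc = uniformly_continuous_of_contraction[OF assms(1)]
  note ext = completion_ext[OF uc]
  have img: "?\<Phi> y \<in> artin_completion S m" if "y \<in> artin_completion S m" for y
    using continuous_map_image_subset_topspace[OF ext(1)] that by auto
  have \<phi>: "\<phi> \<in> carrier M \<rightarrow> carrier M" using assms(1) by (simp add: contraction_on_def)
  have "(0 :: real) < (1 / 2) ^ k" by simp
  then obtain \<delta> where \<delta>: "0 < \<delta>"
    "\<And>y. y \<in> artin_completion S m \<Longrightarrow> d1 S m x y < \<delta> \<Longrightarrow> d1 S m (?\<Phi> x) (?\<Phi> y) < (1 / 2) ^ k"
    using ext(1) assms(2) unfolding C.metric_continuous_map[OF C.Metric_space_axioms] by meson
  obtain n where n: "(1 / 2) ^ n < \<delta>" using half_power_less \<delta>(1) by blast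
  let ?N = "max n k"
  let ?u = "truncation ?N x" and ?v = "truncation k x"
  have u: "?u \<in> carrier M" and v: "?v \<in> carrier M" using truncation[OF assms(2)] by auto
  have "d1 S m x (Inl ?u) \<le> (1 / 2) ^ n"
    using d1_le_iff[OF assms(2), of "Inl ?u" n] truncation(2)[OF assms(2), of n ?N] u by simp
  then have "d1 S m (?\<Phi> x) (?\<Phi> (Inl ?u)) \<le> (1 / 2) ^ k"
    using \<delta>(2)[of "Inl ?u"] u n by simp
  then have "agree k (?\<Phi> x) (Inl (\<phi> ?u))"
    using d1_le_iff[OF img[OF assms(2)] img[of "Inl ?u"], of k] u ext(2)[OF u] by simp
  moreover have "agree k (Inl ?u) (Inl ?v)"
    using truncation(2)[OF assms(2), of k ?N] truncation(2)[OF assms(2), of k k] by simp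
  then have "agree k (Inl (\<phi> ?u)) (Inl (\<phi> ?v))"
    using assms(1) u v unfolding contraction_on_iff_agree[OF \<phi>] by blast
  ultimately show ?thesis by simp
qed

lemma contraction_completion_ext:
  assumes "contraction_on (carrier M) (d1_fin S m) \<phi>"
  shows "contraction_on (artin_completion S m) (d1 S m) (completion_ext S m \<phi>)"
  unfolding contraction_on_def
proof (intro conjI ballI)
  let ?\<Phi> = "completion_ext S m \<phi>"
  note ext = completion_ext[OF uniformly_continuous_of_contraction[OF assms]]
  show img: "?\<Phi> \<in> artin_completion S m \<rightarrow> artin_completion S m"
    using continuous_map_image_subset_topspace[OF ext(1)] by auto
  fix x y
  assume x: "x \<in> artin_completion S m" and y: "y \<in> artin_completion S m"
  have "agree k (?\<Phi> x) (?\<Phi> y)" if "agree k x y" for k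
  proof -
    have "truncation k x = truncation k y"
      using nf_take_cong[OF x y that] by (simp add: truncation_def)
    then show ?thesis
      using completion_ext_agree_truncation[OF assms x, of k]
        completion_ext_agree_truncation[OF assms y, of k] by simp
  qed
  then show "d1 S m (?\<Phi> x) (?\<Phi> y) \<le> d1 S m x y"
    using d1_le_d1_iff[OF x y, of "?\<Phi> x" "?\<Phi> y"] img x y by blast
qed

lemma agree_Suc: "agree (Suc k) (Inl u) (Inl v) \<longleftrightarrow> \<alpha> u = \<alpha> v \<and> agree k (Inl (rest u)) (Inl (rest v))"
  by (simp add: All_less_Suc2)

text \<open>
  Left translations are contractions. The first term of \<open>x y\<close> is that of \<open>x (\<alpha> y)\<close>, and the rest
  is \<open>rest y\<close> multiplied by an element that depends on \<open>x\<close> and \<open>\<alpha> y\<close> only.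
\<close>

lemma agree_mult_left:
  assumes "x \<in> carrier M" "y \<in> carrier M" "y' \<in> carrier M" "agree k (Inl y) (Inl y')"
  shows "agree k (Inl (x \<otimes>\<^bsub>M\<^esub> y)) (Inl (x \<otimes>\<^bsub>M\<^esub> y'))"
  using assms
proof (induction k arbitrary: x y y')
  case (Suc k)
  note c = Suc.prems(1-3)
  have yy: "\<alpha> y = \<alpha> y'" "agree k (Inl (rest y)) (Inl (rest y'))"
    using Suc.prems(4) unfolding agree_Suc by blast+
  let ?w = "x \<otimes>\<^bsub>M\<^esub> \<alpha> y"
  have w: "?w \<in> carrier M" using c alpha_carrier by simp
  have r: "\<alpha> (x \<otimes>\<^bsub>M\<^esub> z) = \<alpha> ?w \<and> rest (x \<otimes>\<^bsub>M\<^esub> z) = rest ?w \<otimes>\<^bsub>M\<^esub> rest z"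
    if z: "z \<in> carrier M" "\<alpha> z = \<alpha> y" for z
  proof
    show a: "\<alpha> (x \<otimes>\<^bsub>M\<^esub> z) = \<alpha> ?w" using alpha_mult[OF c(1) z(1)] z(2) by simp
    have "x \<otimes>\<^bsub>M\<^esub> z = ?w \<otimes>\<^bsub>M\<^esub> rest z"
      using rest[OF z(1)] z(2) c alpha_carrier by (simp add: M.m_assoc)
    also have "\<dots> = \<alpha> ?w \<otimes>\<^bsub>M\<^esub> (rest ?w \<otimes>\<^bsub>M\<^esub> rest z)"
      using rest[OF w] rest(1)[OF z(1)] alpha_carrier[OF w] M.m_assoc by metis
    finally show "rest (x \<otimes>\<^bsub>M\<^esub> z) = rest ?w \<otimes>\<^bsub>M\<^esub> rest z"
      unfolding a[symmetric] using c z rest(1)[OF w] rest(1)[OF z(1)] by (intro rest_eqI) auto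
  qed
  have "agree k (Inl (rest ?w \<otimes>\<^bsub>M\<^esub> rest y)) (Inl (rest ?w \<otimes>\<^bsub>M\<^esub> rest y'))"
    by (rule Suc.IH[OF rest(1)[OF w] rest(1)[OF c(2)] rest(1)[OF c(3)] yy(2)])
  then show ?case
    unfolding agree_Suc using r[OF c(2) HOL.refl] r[OF c(3) yy(1)[symmetric]] by simp
qed simp

context
  fixes \<phi> :: "'a list set \<Rightarrow> 'a list set"
  assumes End: "\<phi> \<in> monoid_End M"
begin

lemma End_simps:
  "u \<in> carrier M \<Longrightarrow> \<phi> u \<in> carrier M"
  "u \<in> carrier M \<Longrightarrow> v \<in> carrier M \<Longrightarrow> \<phi> (u \<otimes>\<^bsub>M\<^esub> v) = \<phi> u \<otimes>\<^bsub>M\<^esub> \<phi> v"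
  using End by (auto simp: monoid_End_def hom_def)

text \<open>
  With \<open>a = \<alpha> u\<close>, compatibility with \<open>\<alpha>\<close> gives \<open>\<phi> u\<close> the first term \<open>\<alpha> (\<phi> a)\<close> and the rest
  \<open>rest (\<phi> a)\<close> times \<open>\<phi> (rest u)\<close>.
\<close>

lemma agree_of_alpha_compatible:
  assumes comp: "\<forall>u\<in>carrier M. \<alpha> (\<phi> u) = \<alpha> (\<phi> (\<alpha> u))"
    and "u \<in> carrier M" "v \<in> carrier M" "agree k (Inl u) (Inl v)"
  shows "agree k (Inl (\<phi> u)) (Inl (\<phi> v))"
  using assms(2-)
proof (induction k arbitrary: u v)
  case (Suc k)
  note c = Suc.prems(1,2)
  have uv: "\<alpha> u = \<alpha> v" "agree k (Inl (rest u)) (Inl (rest v))"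
    using Suc.prems(3) unfolding agree_Suc by blast+
  let ?a = "\<phi> (\<alpha> u)"
  have a: "?a \<in> carrier M" using c(1) by (simp add: End_simps alpha_carrier)
  have r: "\<alpha> (\<phi> z) = \<alpha> ?a \<and> rest (\<phi> z) = rest ?a \<otimes>\<^bsub>M\<^esub> \<phi> (rest z)"
    if z: "z \<in> carrier M" "\<alpha> z = \<alpha> u" for z
  proof
    show e: "\<alpha> (\<phi> z) = \<alpha> ?a" using comp z by metis
    have pz: "\<phi> (rest z) \<in> carrier M" using z by (simp add: End_simps rest)
    have "\<phi> z = ?a \<otimes>\<^bsub>M\<^esub> \<phi> (rest z)"
      using End_simps(2)[OF alpha_carrier[OF z(1)] rest(1)[OF z(1)]] rest(2)[OF z(1)] z(2) by simp
    also have "\<dots> = \<alpha> ?a \<otimes>\<^bsub>M\<^esub> (rest ?a \<otimes>\<^bsub>M\<^esub> \<phi> (rest z))"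
      using rest[OF a] pz alpha_carrier[OF a] M.m_assoc by metis
    finally show "rest (\<phi> z) = rest ?a \<otimes>\<^bsub>M\<^esub> \<phi> (rest z)"
      unfolding e[symmetric] using pz rest(1)[OF a] End_simps(1)[OF z(1)] by (intro rest_eqI) auto
  qed
  have "agree k (Inl (\<phi> (rest u))) (Inl (\<phi> (rest v)))"
    using Suc.IH c uv(2) rest(1) by blast
  then have "agree k (Inl (rest ?a \<otimes>\<^bsub>M\<^esub> \<phi> (rest u))) (Inl (rest ?a \<otimes>\<^bsub>M\<^esub> \<phi> (rest v)))"
    using c by (intro agree_mult_left rest a) (auto simp: End_simps rest)
  then show ?case
    unfolding agree_Suc using r[OF c(1) HOL.refl] r[OF c(2) uv(1)[symmetric]] by simp
qed simp

text \<open>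
  The normal forms of \<open>u v\<close> and \<open>u\<close> have the same first term, so the distance of the two elements
  is at most one half.
\<close>

lemma alpha_compatible_on_pairs_of_contraction:
  assumes "contraction_on (carrier M) (d1_fin S m) \<phi>"
    and "u \<in> artin_red S m" "v \<in> artin_red S m" "\<alpha> (u \<otimes>\<^bsub>M\<^esub> v) = u"
  shows "\<alpha> (\<phi> (u \<otimes>\<^bsub>M\<^esub> v)) = \<alpha> (\<phi> u)"
proof -
  have \<phi>: "\<phi> \<in> carrier M \<rightarrow> carrier M" using End_simps(1) by blast
  have "agree k (Inl (\<phi> x)) (Inl (\<phi> y))"
    if "x \<in> carrier M" "y \<in> carrier M" "agree k (Inl x) (Inl y)" for x y k
    using assms(1) that unfolding contraction_on_iff_agree[OF \<phi>] by blast
  from this[of "u \<otimes>\<^bsub>M\<^esub> v" u 1] show ?thesis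
    using assms(2-4) by (simp add: alpha_red artin_red_carrier)
qed

text \<open>
  Let \<open>a\<close> and \<open>b\<close> be the first two terms of the normal form of \<open>u\<close>. Then \<open>\<alpha> (a b) = a\<close>, and by
  induction the factor \<open>\<phi> (rest u)\<close> of \<open>\<phi> u\<close> may be replaced by \<open>\<phi> b\<close> under \<open>\<alpha>\<close>.
\<close>

lemma alpha_compatible_of_pairs:
  assumes pairs: "\<forall>u\<in>artin_red S m. \<forall>v\<in>artin_red S m.
      \<alpha> (u \<otimes>\<^bsub>M\<^esub> v) = u \<longrightarrow> \<alpha> (\<phi> (u \<otimes>\<^bsub>M\<^esub> v)) = \<alpha> (\<phi> u)"
    and "u \<in> carrier M"
  shows "\<alpha> (\<phi> u) = \<alpha> (\<phi> (\<alpha> u))"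
  using assms(2)
proof (induction "mlen u" arbitrary: u rule: less_induct)
  case less
  note u = less.prems
  show ?case
  proof (cases "u = \<one>\<^bsub>M\<^esub>")
    case True
    then show ?thesis by (simp add: alpha_one)
  next
    case False
    let ?a = "\<alpha> u" and ?b = "\<alpha> (rest u)"
    have c: "?a \<in> carrier M" "rest u \<in> carrier M" "?b \<in> carrier M"
      using u rest alpha_carrier by auto
    have ab: "\<alpha> (?a \<otimes>\<^bsub>M\<^esub> ?b) = ?a"
      using alpha_mult[OF c(1,2)] rest(2)[OF u] by simp
    have "\<alpha> (\<phi> u) = \<alpha> (\<phi> ?a \<otimes>\<^bsub>M\<^esub> \<phi> (rest u))"
      using End_simps(2)[OF c(1,2)] rest(2)[OF u] by simp
    also have "\<dots> = \<alpha> (\<phi> ?a \<otimes>\<^bsub>M\<^esub> \<alpha> (\<phi> (rest u)))"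
      by (rule alpha_mult[OF End_simps(1)[OF c(1)] End_simps(1)[OF c(2)]])
    also have "\<dots> = \<alpha> (\<phi> ?a \<otimes>\<^bsub>M\<^esub> \<alpha> (\<phi> ?b))"
      using less.hyps[OF mlen_rest[OF u False] c(2)] by simp
    also have "\<dots> = \<alpha> (\<phi> ?a \<otimes>\<^bsub>M\<^esub> \<phi> ?b)"
      by (rule alpha_mult[OF End_simps(1)[OF c(1)] End_simps(1)[OF c(3)], symmetric])
    also have "\<dots> = \<alpha> (\<phi> (?a \<otimes>\<^bsub>M\<^esub> ?b))" by (simp only: End_simps(2)[OF c(1,3)])
    also have "\<dots> = \<alpha> (\<phi> ?a)"
      using pairs ab alpha_greatest(1)[OF u] alpha_greatest(1)[OF c(2)] by blast
    finally show ?thesis .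
  qed
qed

end

end

theorem theorem4p2:
  fixes S :: "'a set" and m :: "'a \<Rightarrow> 'a \<Rightarrow> enat" and \<phi> :: "'a list set \<Rightarrow> 'a list set"
  assumes "coxeter_matrix S m"
    and "\<phi> \<in> monoid_End (artin_monoid S m)"
  shows
   "((uniformly_continuous_map (artin_metric S m) (artin_metric S m) \<phi> \<and>
      contraction_on (artin_completion S m) (d1 S m) (completion_ext S m \<phi>))
     \<longleftrightarrow> contraction_on (carrier (artin_monoid S m)) (d1_fin S m) \<phi>)
  \<and> (contraction_on (carrier (artin_monoid S m)) (d1_fin S m) \<phi>
     \<longleftrightarrow> (\<forall>u \<in> artin_red S m. \<forall>v \<in> artin_red S m.
           alpha S m (u \<otimes>\<^bsub>artin_monoid S m\<^esub> v) = u \<longrightarrow>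
           alpha S m (\<phi> (u \<otimes>\<^bsub>artin_monoid S m\<^esub> v)) = alpha S m (\<phi> u)))
  \<and> ((\<forall>u \<in> artin_red S m. \<forall>v \<in> artin_red S m.
           alpha S m (u \<otimes>\<^bsub>artin_monoid S m\<^esub> v) = u \<longrightarrow>
           alpha S m (\<phi> (u \<otimes>\<^bsub>artin_monoid S m\<^esub> v)) = alpha S m (\<phi> u))
     \<longleftrightarrow> (\<forall>u \<in> carrier (artin_monoid S m).
           alpha S m (\<phi> u) = alpha S m (\<phi> (alpha S m u))))
  \<and> ((\<forall>u \<in> carrier (artin_monoid S m).
           alpha S m (\<phi> u) = alpha S m (\<phi> (alpha S m u)))
     \<longrightarrow> (\<forall>x \<in> artin_completion S m. \<forall>k::nat. 1 \<le> k \<and> enat k \<le> nf_length S m x \<longrightarrow>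
           take k (iota1 S m (\<phi> (mprod (artin_monoid S m) (nf_take S m k x))))
             = nf_take S m k (completion_ext S m \<phi> x)))"
    (is "(?i \<longleftrightarrow> ?ii) \<and> (?ii \<longleftrightarrow> ?iii) \<and> (?iii \<longleftrightarrow> ?iv) \<and> (?iv \<longrightarrow> ?normal_forms)")
proof -
  interpret coxeter_data S m by (rule coxeter_data.intro[OF assms(1)])
  have \<phi>: "\<phi> \<in> carrier M \<rightarrow> carrier M" using End_simps(1)[OF assms(2)] by blast
  have i_ii: ?ii if ?i
  proof -
    note ext = completion_ext(2)[OF conjunct1[OF that]]
    have "d1_fin S m (\<phi> u) (\<phi> v) \<le> d1_fin S m u v" if uv: "u \<in> carrier M" "v \<in> carrier M" for u v
      using \<open>?i\<close> uv ext[OF uv(1)] ext[OF uv(2)] unfolding contraction_on_def d1_fin_def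
      by (metis Inl_completion)
    then show ?thesis using \<phi> by (simp add: contraction_on_def)
  qed
  have ii_i: ?i if ?ii
    using uniformly_continuous_of_contraction[OF that] contraction_completion_ext[OF that] by blast
  have ii_iii: ?iii if ?ii
    using alpha_compatible_on_pairs_of_contraction[OF assms(2) that] by blast
  have iii_iv: ?iv if ?iii
    using alpha_compatible_of_pairs[OF assms(2) that] by blast
  have iv_iii: ?iii if ?iv
  proof (intro ballI impI)
    fix u v
    assume "u \<in> artin_red S m" "v \<in> artin_red S m" and uv: "\<alpha> (u \<otimes>\<^bsub>M\<^esub> v) = u"
    then have "u \<otimes>\<^bsub>M\<^esub> v \<in> carrier M" by (simp add: artin_red_carrier)
    then show "\<alpha> (\<phi> (u \<otimes>\<^bsub>M\<^esub> v)) = \<alpha> (\<phi> u)" using \<open>?iv\<close> uv by metis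
  qed
  have iv_ii: ?ii if ?iv
    unfolding contraction_on_iff_agree[OF \<phi>]
    using agree_of_alpha_compatible[OF assms(2) that] by blast
  have normal_forms: ?normal_forms if ?iv
  proof (intro ballI allI impI)
    fix x k
    assume x: "x \<in> artin_completion S m"
    note contr = iv_ii[OF that]
    have "nf_take S m k (completion_ext S m \<phi> x) = nf_take S m k (Inl (\<phi> (truncation k x)))"
    proof (rule nf_take_cong)
      show "completion_ext S m \<phi> x \<in> artin_completion S m"
        using contraction_completion_ext[OF contr] x by (auto simp: contraction_on_def)
      show "Inl (\<phi> (truncation k x)) \<in> artin_completion S m"
        using \<phi> truncation(1)[OF x] by auto
    qed (rule completion_ext_agree_truncation[OF contr x])
    then show "take k (iota1 S m (\<phi> (mprod M (nf_take S m k x)))) = nf_take S m k (completion_ext S m \<phi> x)"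
      by (simp add: nf_take_def truncation_def)
  qed
  show ?thesis
    by (rule conjI[OF iffI[OF i_ii ii_i] conjI[OF iffI[OF ii_iii iv_ii[OF iii_iv]]
          conjI[OF iffI[OF iii_iv iv_iii] impI[OF normal_forms]]]])
qed

end
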